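(* Let $T$ be an opmonoidal monad on a monoidal category $\mathcal{W}$. The right fusion operators of $T$ are invertible if and only if the coherence morphisms $(T_{\mathsf a})_{X,W}$ of the canonical oplax $\mathbf{EM}(T)$-module structure on $T$ are invertible for all $X\in\mathbf{EM}(T)$ and $W\in\mathcal{W}$. In other words, $T$ is a right Hopf monad if and only if it is a strong $\mathbf{EM}(T)$-module monad when endowed with this structure.
   Context: All categories and functors are linear over a fixed field. An opmonoidal monad is a monad $(T,\mu,\eta)$ on $\mathcal{W}$ with an oplax monoidal structure $(T_{\mathsf m})_{V,W}\colon T(V\otimes W)\to T(V)\otimes T(W)$, $T(\mathbb{1})\to\mathbb{1}$, such that $\mu$ and $\eta$ are opmonoidal transformations. The Eilenberg--Moore category $\mathbf{EM}(T)$ is then monoidal such that the forgetful functor $U\colon\mathbf{EM}(T)\to\mathcal{W}$ is strict monoidal; let $F\dashv U$ be the free-forgetful (opmonoidal) adjunction, with counit $\varepsilon$, so that $T=UF$. The right fusion operator of $T$ is the natural transformation $$(T_{\mathbf f})_{V,W}\colon T(T(V)\otimes W)\xrightarrow{(T_{\mathsf m})_{T(V),W}}T^2(V)\otimes T(W)\xrightarrow{\mu_V\otimes T(W)}T(V)\otimes T(W),\quad V,W\in\mathcal{W};$$ $T$ is a right Hopf monad if $T_{\mathbf f}$ is invertible. $\mathcal{W}$ is a left $\mathbf{EM}(T)$-module category via $X\triangleright W=U(X)\otimes W$. The canonical oplax $\mathbf{EM}(T)$-module structure on the monad $T$ is given, for $X\in\mathbf{EM}(T)$ and $W\in\mathcal{W}$,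 by $$(T_{\mathsf a})_{X,W}\colon T(X\triangleright W)=T(U(X)\otimes W)\xrightarrow{(T_{\mathsf m})_{U(X),W}}TU(X)\otimes T(W)\xrightarrow{U(\varepsilon_X)\otimes T(W)}U(X)\otimes T(W)=X\triangleright T(W).$$ *)

theory Defs
  imports "HOL-Algebra.Module"
begin

section \<open>Linear categories\<close>

text \<open>
  A category over a field \<open>k\<close>: a set of objects, and for all objects \<open>A\<close>, \<open>B\<close> a hom-space, which is a
  vector space over \<open>k\<close>, i.e. a \<^term>\<open>module\<close> of the algebra library (whose ring multiplication and unit
  are not constrained by the locale \<^term>\<open>module\<close> and play no role).
  Hom-spaces need not be disjoint, and the operations on arrows do not record sources and targets;
  since every category is isomorphic to one with disjoint hom-sets, this is no loss of generality.
  All operations are constrained on objects and arrows of matching type only.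
\<close>

record ('k, 'o, 'a) lincat =
  Obj :: "'o set"
  Hom :: "'o \<Rightarrow> 'o \<Rightarrow> ('k, 'a) module"
  cmp :: "'a \<Rightarrow> 'a \<Rightarrow> 'a" (infixr "\<cdot>\<index>" 65)
  idn :: "'o \<Rightarrow> 'a"

abbreviation arrows :: "('k, 'o, 'a, 'z) lincat_scheme \<Rightarrow> 'o \<Rightarrow> 'o \<Rightarrow> 'a set"
    ("(_ \<leadsto>\<index> _)" [61, 61] 60)
  where "A \<leadsto>\<^bsub>C\<^esub> B \<equiv> carrier (Hom C A B)"

locale linear_category =
  fixes k :: "('k, 'r) ring_scheme"
    and C :: "('k, 'o, 'a, 'z) lincat_scheme" (structure)
  assumes field: "field k"
    and hom_space: "\<lbrakk>A \<in> Obj C; B \<in> Obj C\<rbrakk> \<Longrightarrow> module k (Hom C A B)"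
    and idn_arr: "A \<in> Obj C \<Longrightarrow> idn C A \<in> A \<leadsto> A"
    and cmp_arr: "\<lbrakk>A \<in> Obj C; B \<in> Obj C; D \<in> Obj C; f \<in> A \<leadsto> B; g \<in> B \<leadsto> D\<rbrakk>
      \<Longrightarrow> g \<cdot> f \<in> A \<leadsto> D"
    and cmp_idn: "\<lbrakk>A \<in> Obj C; B \<in> Obj C; f \<in> A \<leadsto> B\<rbrakk> \<Longrightarrow> f \<cdot> idn C A = f"
    and idn_cmp: "\<lbrakk>A \<in> Obj C; B \<in> Obj C; f \<in> A \<leadsto> B\<rbrakk> \<Longrightarrow> idn C B \<cdot> f = f"
    and cmp_assoc: "\<lbrakk>A \<in> Obj C; B \<in> Obj C; D \<in> Obj C; E \<in> Obj C;
        f \<in> A \<leadsto> B; g \<in> B \<leadsto> D; h \<in> D \<leadsto> E\<rbrakk> \<Longrightarrow> (h \<cdot> g) \<cdot> f = h \<cdot> (g \<cdot> f)"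
    and cmp_add_left: "\<lbrakk>A \<in> Obj C; B \<in> Obj C; D \<in> Obj C; f \<in> A \<leadsto> B; g \<in> B \<leadsto> D; g' \<in> B \<leadsto> D\<rbrakk>
      \<Longrightarrow> (g \<oplus>\<^bsub>Hom C B D\<^esub> g') \<cdot> f = (g \<cdot> f) \<oplus>\<^bsub>Hom C A D\<^esub> (g' \<cdot> f)"
    and cmp_add_right: "\<lbrakk>A \<in> Obj C; B \<in> Obj C; D \<in> Obj C; f \<in> A \<leadsto> B; f' \<in> A \<leadsto> B; g \<in> B \<leadsto> D\<rbrakk>
      \<Longrightarrow> g \<cdot> (f \<oplus>\<^bsub>Hom C A B\<^esub> f') = (g \<cdot> f) \<oplus>\<^bsub>Hom C A D\<^esub> (g \<cdot> f')"
    and cmp_smult_left: "\<lbrakk>A \<in> Obj C; B \<in> Obj C; D \<in> Obj C; f \<in> A \<leadsto> B; g \<in> B \<leadsto> D; c \<in> carrier k\<rbrakk>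
      \<Longrightarrow> (c \<odot>\<^bsub>Hom C B D\<^esub> g) \<cdot> f = c \<odot>\<^bsub>Hom C A D\<^esub> (g \<cdot> f)"
    and cmp_smult_right: "\<lbrakk>A \<in> Obj C; B \<in> Obj C; D \<in> Obj C; f \<in> A \<leadsto> B; g \<in> B \<leadsto> D; c \<in> carrier k\<rbrakk>
      \<Longrightarrow> g \<cdot> (c \<odot>\<^bsub>Hom C A B\<^esub> f) = c \<odot>\<^bsub>Hom C A D\<^esub> (g \<cdot> f)"

definition iso_arrow :: "('k, 'o, 'a, 'z) lincat_scheme \<Rightarrow> 'o \<Rightarrow> 'o \<Rightarrow> 'a \<Rightarrow> bool"
  where "iso_arrow C A B f \<longleftrightarrow> f \<in> A \<leadsto>\<^bsub>C\<^esub> B \<and>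
    (\<exists>g \<in> B \<leadsto>\<^bsub>C\<^esub> A. g \<cdot>\<^bsub>C\<^esub> f = idn C A \<and> f \<cdot>\<^bsub>C\<^esub> g = idn C B)"

record ('o, 'a, 'p, 'b) fctr =
  ob :: "'o \<Rightarrow> 'p"
  ar :: "'a \<Rightarrow> 'b"

locale linear_functor =
  C: linear_category k C + D: linear_category k D
  for k :: "('k, 'r) ring_scheme"
    and C :: "('k, 'o, 'a, 'c) lincat_scheme"
    and D :: "('k, 'p, 'b, 'd) lincat_scheme" +
  fixes F :: "('o, 'a, 'p, 'b, 'f) fctr_scheme"
  assumes ob_Obj: "A \<in> Obj C \<Longrightarrow> ob F A \<in> Obj D"
    and ar_arr: "\<lbrakk>A \<in> Obj C; B \<in> Obj C; f \<in> A \<leadsto>\<^bsub>C\<^esub> B\<rbrakk> \<Longrightarrow> ar F f \<in> ob F A \<leadsto>\<^bsub>D\<^esub> ob F B"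
    and ar_idn: "A \<in> Obj C \<Longrightarrow> ar F (idn C A) = idn D (ob F A)"
    and ar_cmp: "\<lbrakk>A \<in> Obj C; B \<in> Obj C; E \<in> Obj C; f \<in> A \<leadsto>\<^bsub>C\<^esub> B; g \<in> B \<leadsto>\<^bsub>C\<^esub> E\<rbrakk>
      \<Longrightarrow> ar F (g \<cdot>\<^bsub>C\<^esub> f) = ar F g \<cdot>\<^bsub>D\<^esub> ar F f"
    and ar_add: "\<lbrakk>A \<in> Obj C; B \<in> Obj C; f \<in> A \<leadsto>\<^bsub>C\<^esub> B; g \<in> A \<leadsto>\<^bsub>C\<^esub> B\<rbrakk>
      \<Longrightarrow> ar F (f \<oplus>\<^bsub>Hom C A B\<^esub> g) = ar F f \<oplus>\<^bsub>Hom D (ob F A) (ob F B)\<^esub> ar F g"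
    and ar_smult: "\<lbrakk>A \<in> Obj C; B \<in> Obj C; f \<in> A \<leadsto>\<^bsub>C\<^esub> B; c \<in> carrier k\<rbrakk>
      \<Longrightarrow> ar F (c \<odot>\<^bsub>Hom C A B\<^esub> f) = c \<odot>\<^bsub>Hom D (ob F A) (ob F B)\<^esub> ar F f"

definition id_fctr :: "('o, 'a, 'o, 'a) fctr"
  where "id_fctr = \<lparr>ob = (\<lambda>A. A), ar = (\<lambda>f. f)\<rparr>"

definition comp_fctr ::
    "('p, 'b, 'q, 'c, 'g) fctr_scheme \<Rightarrow> ('o, 'a, 'p, 'b, 'f) fctr_scheme \<Rightarrow> ('o, 'a, 'q, 'c) fctr"
  where "comp_fctr G F = \<lparr>ob = (\<lambda>A. ob G (ob F A)), ar = (\<lambda>f. ar G (ar F f))\<rparr>"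

locale natural_transformation =
  F: linear_functor k C D F + G: linear_functor k C D G
  for k :: "('k, 'r) ring_scheme"
    and C :: "('k, 'o, 'a, 'c) lincat_scheme"
    and D :: "('k, 'p, 'b, 'd) lincat_scheme"
    and F :: "('o, 'a, 'p, 'b, 'f) fctr_scheme"
    and G :: "('o, 'a, 'p, 'b, 'g) fctr_scheme" +
  fixes \<sigma> :: "'o \<Rightarrow> 'b"
  assumes component: "A \<in> Obj C \<Longrightarrow> \<sigma> A \<in> ob F A \<leadsto>\<^bsub>D\<^esub> ob G A"
    and natural: "\<lbrakk>A \<in> Obj C; B \<in> Obj C; f \<in> A \<leadsto>\<^bsub>C\<^esub> B\<rbrakk>
      \<Longrightarrow> \<sigma> B \<cdot>\<^bsub>D\<^esub> ar F f = ar G f \<cdot>\<^bsub>D\<^esub> \<sigma> A"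

locale linear_monad = linear_functor k C C T
  for k :: "('k, 'r) ring_scheme"
    and C :: "('k, 'o, 'a, 'c) lincat_scheme" (structure)
    and T :: "('o, 'a, 'o, 'a, 't) fctr_scheme" +
  fixes \<mu> :: "'o \<Rightarrow> 'a" and \<eta> :: "'o \<Rightarrow> 'a"
  assumes mu_natural: "natural_transformation k C C (comp_fctr T T) T \<mu>"
    and eta_natural: "natural_transformation k C C id_fctr T \<eta>"
    and mu_assoc: "A \<in> Obj C \<Longrightarrow> \<mu> A \<cdot> ar T (\<mu> A) = \<mu> A \<cdot> \<mu> (ob T A)"
    and mu_eta_left: "A \<in> Obj C \<Longrightarrow> \<mu> A \<cdot> \<eta> (ob T A) = idn C (ob T A)"
    and mu_eta_right: "A \<in> Obj C \<Longrightarrow> \<mu> A \<cdot> ar T (\<eta> A) = idn C (ob T A)"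


section \<open>Monoidal categories and opmonoidal functors\<close>

text \<open>
  The associator has components \<open>(A \<otimes> B) \<otimes> D \<rightarrow> A \<otimes> (B \<otimes> D)\<close>, the unitors have components
  \<open>1 \<otimes> A \<rightarrow> A\<close> and \<open>A \<otimes> 1 \<rightarrow> A\<close>. The subscripts \<open>o\<close> and \<open>a\<close> distinguish the tensor product of objects
  from that of arrows (and both from the ring multiplication of the algebra library).
\<close>

record ('k, 'o, 'a) moncat = "('k, 'o, 'a) lincat" +
  tenso :: "'o \<Rightarrow> 'o \<Rightarrow> 'o" (infixr "\<otimes>\<^sub>o\<index>" 75)
  tensa :: "'a \<Rightarrow> 'a \<Rightarrow> 'a" (infixr "\<otimes>\<^sub>a\<index>" 75)
  unito :: "'o"
  associator :: "'o \<Rightarrow> 'o \<Rightarrow> 'o \<Rightarrow> 'a"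
  lunitor :: "'o \<Rightarrow> 'a"
  runitor :: "'o \<Rightarrow> 'a"

locale monoidal_category = linear_category k C
  for k :: "('k, 'r) ring_scheme"
    and C :: "('k, 'o, 'a, 'z) moncat_scheme" (structure) +
  assumes unito_Obj: "unito C \<in> Obj C"
    and tenso_Obj: "\<lbrakk>A \<in> Obj C; B \<in> Obj C\<rbrakk> \<Longrightarrow> A \<otimes>\<^sub>o B \<in> Obj C"
    and tensa_arr: "\<lbrakk>A \<in> Obj C; A' \<in> Obj C; B \<in> Obj C; B' \<in> Obj C; f \<in> A \<leadsto> A'; g \<in> B \<leadsto> B'\<rbrakk>
      \<Longrightarrow> f \<otimes>\<^sub>a g \<in> (A \<otimes>\<^sub>o B) \<leadsto> (A' \<otimes>\<^sub>o B')"
    and tensa_idn: "\<lbrakk>A \<in> Obj C; B \<in> Obj C\<rbrakk> \<Longrightarrow> idn C A \<otimes>\<^sub>a idn C B = idn C (A \<otimes>\<^sub>o B)"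
    and tensa_cmp: "\<lbrakk>A \<in> Obj C; A' \<in> Obj C; A'' \<in> Obj C; B \<in> Obj C; B' \<in> Obj C; B'' \<in> Obj C;
        f \<in> A \<leadsto> A'; f' \<in> A' \<leadsto> A''; g \<in> B \<leadsto> B'; g' \<in> B' \<leadsto> B''\<rbrakk>
      \<Longrightarrow> (f' \<cdot> f) \<otimes>\<^sub>a (g' \<cdot> g) = (f' \<otimes>\<^sub>a g') \<cdot> (f \<otimes>\<^sub>a g)"
    and tensa_add_left: "\<lbrakk>A \<in> Obj C; A' \<in> Obj C; B \<in> Obj C; B' \<in> Obj C;
        f \<in> A \<leadsto> A'; f' \<in> A \<leadsto> A'; g \<in> B \<leadsto> B'\<rbrakk>
      \<Longrightarrow> (f \<oplus>\<^bsub>Hom C A A'\<^esub> f') \<otimes>\<^sub>a g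
        = (f \<otimes>\<^sub>a g) \<oplus>\<^bsub>Hom C (A \<otimes>\<^sub>o B) (A' \<otimes>\<^sub>o B')\<^esub> (f' \<otimes>\<^sub>a g)"
    and tensa_add_right: "\<lbrakk>A \<in> Obj C; A' \<in> Obj C; B \<in> Obj C; B' \<in> Obj C;
        f \<in> A \<leadsto> A'; g \<in> B \<leadsto> B'; g' \<in> B \<leadsto> B'\<rbrakk>
      \<Longrightarrow> f \<otimes>\<^sub>a (g \<oplus>\<^bsub>Hom C B B'\<^esub> g')
        = (f \<otimes>\<^sub>a g) \<oplus>\<^bsub>Hom C (A \<otimes>\<^sub>o B) (A' \<otimes>\<^sub>o B')\<^esub> (f \<otimes>\<^sub>a g')"
    and tensa_smult_left: "\<lbrakk>A \<in> Obj C; A' \<in> Obj C; B \<in> Obj C; B' \<in> Obj C;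
        f \<in> A \<leadsto> A'; g \<in> B \<leadsto> B'; c \<in> carrier k\<rbrakk>
      \<Longrightarrow> (c \<odot>\<^bsub>Hom C A A'\<^esub> f) \<otimes>\<^sub>a g = c \<odot>\<^bsub>Hom C (A \<otimes>\<^sub>o B) (A' \<otimes>\<^sub>o B')\<^esub> (f \<otimes>\<^sub>a g)"
    and tensa_smult_right: "\<lbrakk>A \<in> Obj C; A' \<in> Obj C; B \<in> Obj C; B' \<in> Obj C;
        f \<in> A \<leadsto> A'; g \<in> B \<leadsto> B'; c \<in> carrier k\<rbrakk>
      \<Longrightarrow> f \<otimes>\<^sub>a (c \<odot>\<^bsub>Hom C B B'\<^esub> g) = c \<odot>\<^bsub>Hom C (A \<otimes>\<^sub>o B) (A' \<otimes>\<^sub>o B')\<^esub> (f \<otimes>\<^sub>a g)"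
    and associator_iso: "\<lbrakk>A \<in> Obj C; B \<in> Obj C; D \<in> Obj C\<rbrakk>
      \<Longrightarrow> iso_arrow C ((A \<otimes>\<^sub>o B) \<otimes>\<^sub>o D) (A \<otimes>\<^sub>o (B \<otimes>\<^sub>o D)) (associator C A B D)"
    and associator_natural: "\<lbrakk>A \<in> Obj C; A' \<in> Obj C; B \<in> Obj C; B' \<in> Obj C; D \<in> Obj C; D' \<in> Obj C;
        f \<in> A \<leadsto> A'; g \<in> B \<leadsto> B'; h \<in> D \<leadsto> D'\<rbrakk>
      \<Longrightarrow> associator C A' B' D' \<cdot> ((f \<otimes>\<^sub>a g) \<otimes>\<^sub>a h) = (f \<otimes>\<^sub>a (g \<otimes>\<^sub>a h)) \<cdot> associator C A B D"
    and lunitor_iso: "A \<in> Obj C \<Longrightarrow> iso_arrow C (unito C \<otimes>\<^sub>o A) A (lunitor C A)"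
    and lunitor_natural: "\<lbrakk>A \<in> Obj C; A' \<in> Obj C; f \<in> A \<leadsto> A'\<rbrakk>
      \<Longrightarrow> lunitor C A' \<cdot> (idn C (unito C) \<otimes>\<^sub>a f) = f \<cdot> lunitor C A"
    and runitor_iso: "A \<in> Obj C \<Longrightarrow> iso_arrow C (A \<otimes>\<^sub>o unito C) A (runitor C A)"
    and runitor_natural: "\<lbrakk>A \<in> Obj C; A' \<in> Obj C; f \<in> A \<leadsto> A'\<rbrakk>
      \<Longrightarrow> runitor C A' \<cdot> (f \<otimes>\<^sub>a idn C (unito C)) = f \<cdot> runitor C A"
    and pentagon: "\<lbrakk>A \<in> Obj C; B \<in> Obj C; D \<in> Obj C; E \<in> Obj C\<rbrakk>
      \<Longrightarrow> associator C A B (D \<otimes>\<^sub>o E) \<cdot> associator C (A \<otimes>\<^sub>o B) D E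
        = (idn C A \<otimes>\<^sub>a associator C B D E) \<cdot> associator C A (B \<otimes>\<^sub>o D) E
          \<cdot> (associator C A B D \<otimes>\<^sub>a idn C E)"
    and triangle: "\<lbrakk>A \<in> Obj C; B \<in> Obj C\<rbrakk>
      \<Longrightarrow> (idn C A \<otimes>\<^sub>a lunitor C B) \<cdot> associator C A (unito C) B = runitor C A \<otimes>\<^sub>a idn C B"

text \<open>
  An opmonoidal functor carries comparison morphisms \<open>F (V \<otimes> W) \<rightarrow> F V \<otimes> F W\<close> and \<open>F 1 \<rightarrow> 1\<close>.
\<close>

record ('o, 'a, 'p, 'b) opfctr = "('o, 'a, 'p, 'b) fctr" +
  opm :: "'o \<Rightarrow> 'o \<Rightarrow> 'b"
  opu :: "'b"

locale opmonoidal_functor =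
  linear_functor k C D F + C: monoidal_category k C + D: monoidal_category k D
  for k :: "('k, 'r) ring_scheme"
    and C :: "('k, 'o, 'a, 'c) moncat_scheme"
    and D :: "('k, 'p, 'b, 'd) moncat_scheme"
    and F :: "('o, 'a, 'p, 'b, 'f) opfctr_scheme" +
  assumes opm_arr: "\<lbrakk>V \<in> Obj C; W \<in> Obj C\<rbrakk>
      \<Longrightarrow> opm F V W \<in> ob F (V \<otimes>\<^sub>o\<^bsub>C\<^esub> W) \<leadsto>\<^bsub>D\<^esub> (ob F V \<otimes>\<^sub>o\<^bsub>D\<^esub> ob F W)"
    and opm_natural: "\<lbrakk>V \<in> Obj C; V' \<in> Obj C; W \<in> Obj C; W' \<in> Obj C;
        f \<in> V \<leadsto>\<^bsub>C\<^esub> V'; g \<in> W \<leadsto>\<^bsub>C\<^esub> W'\<rbrakk>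
      \<Longrightarrow> opm F V' W' \<cdot>\<^bsub>D\<^esub> ar F (f \<otimes>\<^sub>a\<^bsub>C\<^esub> g) = (ar F f \<otimes>\<^sub>a\<^bsub>D\<^esub> ar F g) \<cdot>\<^bsub>D\<^esub> opm F V W"
    and opu_arr: "opu F \<in> ob F (unito C) \<leadsto>\<^bsub>D\<^esub> unito D"
    and op_coassociative: "\<lbrakk>V \<in> Obj C; W \<in> Obj C; Z \<in> Obj C\<rbrakk>
      \<Longrightarrow> associator D (ob F V) (ob F W) (ob F Z)
          \<cdot>\<^bsub>D\<^esub> (opm F V W \<otimes>\<^sub>a\<^bsub>D\<^esub> idn D (ob F Z)) \<cdot>\<^bsub>D\<^esub> opm F (V \<otimes>\<^sub>o\<^bsub>C\<^esub> W) Z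
        = (idn D (ob F V) \<otimes>\<^sub>a\<^bsub>D\<^esub> opm F W Z) \<cdot>\<^bsub>D\<^esub> opm F V (W \<otimes>\<^sub>o\<^bsub>C\<^esub> Z)
          \<cdot>\<^bsub>D\<^esub> ar F (associator C V W Z)"
    and op_counital_left: "V \<in> Obj C
      \<Longrightarrow> lunitor D (ob F V) \<cdot>\<^bsub>D\<^esub> (opu F \<otimes>\<^sub>a\<^bsub>D\<^esub> idn D (ob F V)) \<cdot>\<^bsub>D\<^esub> opm F (unito C) V
        = ar F (lunitor C V)"
    and op_counital_right: "V \<in> Obj C
      \<Longrightarrow> runitor D (ob F V) \<cdot>\<^bsub>D\<^esub> (idn D (ob F V) \<otimes>\<^sub>a\<^bsub>D\<^esub> opu F) \<cdot>\<^bsub>D\<^esub> opm F V (unito C)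
        = ar F (runitor C V)"

definition id_opfctr :: "('k, 'o, 'a, 'c) moncat_scheme \<Rightarrow> ('o, 'a, 'o, 'a) opfctr"
  where "id_opfctr C = \<lparr>ob = (\<lambda>A. A), ar = (\<lambda>f. f),
    opm = (\<lambda>V W. idn C (V \<otimes>\<^sub>o\<^bsub>C\<^esub> W)), opu = idn C (unito C)\<rparr>"

definition comp_opfctr ::
    "('k, 'q, 'c, 'e) moncat_scheme \<Rightarrow> ('p, 'b, 'q, 'c, 'g) opfctr_scheme
      \<Rightarrow> ('o, 'a, 'p, 'b, 'f) opfctr_scheme \<Rightarrow> ('o, 'a, 'q, 'c) opfctr"
  where "comp_opfctr E G F = \<lparr>ob = (\<lambda>A. ob G (ob F A)), ar = (\<lambda>f. ar G (ar F f)),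
    opm = (\<lambda>V W. opm G (ob F V) (ob F W) \<cdot>\<^bsub>E\<^esub> ar G (opm F V W)),
    opu = opu G \<cdot>\<^bsub>E\<^esub> ar G (opu F)\<rparr>"

locale opmonoidal_transformation =
  natural_transformation k C D F G \<sigma> +
  F: opmonoidal_functor k C D F + G: opmonoidal_functor k C D G
  for k :: "('k, 'r) ring_scheme"
    and C :: "('k, 'o, 'a, 'c) moncat_scheme"
    and D :: "('k, 'p, 'b, 'd) moncat_scheme"
    and F :: "('o, 'a, 'p, 'b, 'f) opfctr_scheme"
    and G :: "('o, 'a, 'p, 'b, 'g) opfctr_scheme"
    and \<sigma> :: "'o \<Rightarrow> 'b" +
  assumes opm_compatible: "\<lbrakk>V \<in> Obj C; W \<in> Obj C\<rbrakk>
      \<Longrightarrow> opm G V W \<cdot>\<^bsub>D\<^esub> \<sigma> (V \<otimes>\<^sub>o\<^bsub>C\<^esub> W) = (\<sigma> V \<otimes>\<^sub>a\<^bsub>D\<^esub> \<sigma> W) \<cdot>\<^bsub>D\<^esub> opm F V W"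
    and opu_compatible: "opu G \<cdot>\<^bsub>D\<^esub> \<sigma> (unito C) = opu F"

record ('o, 'a) opmonad = "('o, 'a, 'o, 'a) opfctr" +
  mu :: "'o \<Rightarrow> 'a"
  eta :: "'o \<Rightarrow> 'a"

locale opmonoidal_monad =
  linear_monad k W T "mu T" "eta T" + opmonoidal_functor k W W T
  for k :: "('k, 'r) ring_scheme"
    and W :: "('k, 'o, 'a, 'w) moncat_scheme" (structure)
    and T :: "('o, 'a, 't) opmonad_scheme" +
  assumes mu_opmonoidal: "opmonoidal_transformation k W W (comp_opfctr W T T) T (mu T)"
    and eta_opmonoidal: "opmonoidal_transformation k W W (id_opfctr W) T (eta T)"


section \<open>Right Hopf monads\<close>

definition right_fusion ::
    "('k, 'o, 'a, 'w) moncat_scheme \<Rightarrow> ('o, 'a, 't) opmonad_scheme \<Rightarrow> 'o \<Rightarrow> 'o \<Rightarrow> 'a"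
  where "right_fusion W T V X =
    (mu T V \<otimes>\<^sub>a\<^bsub>W\<^esub> idn W (ob T X)) \<cdot>\<^bsub>W\<^esub> opm T (ob T V) X"

definition right_fusion_invertible ::
    "('k, 'o, 'a, 'w) moncat_scheme \<Rightarrow> ('o, 'a, 't) opmonad_scheme \<Rightarrow> bool"
  where "right_fusion_invertible W T \<longleftrightarrow> (\<forall>V \<in> Obj W. \<forall>X \<in> Obj W.
    iso_arrow W (ob T (ob T V \<otimes>\<^sub>o\<^bsub>W\<^esub> X)) (ob T V \<otimes>\<^sub>o\<^bsub>W\<^esub> ob T X) (right_fusion W T V X))"

definition right_hopf_monad ::
    "('k, 'r) ring_scheme \<Rightarrow> ('k, 'o, 'a, 'w) moncat_scheme \<Rightarrow> ('o, 'a, 't) opmonad_scheme \<Rightarrow> bool"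
  where "right_hopf_monad k W T \<longleftrightarrow> opmonoidal_monad k W T \<and> right_fusion_invertible W T"


section \<open>The Eilenberg--Moore category\<close>

text \<open>
  Objects are the pairs \<open>(A, a)\<close> with an action \<open>a\<close> of \<open>T\<close> on \<open>A\<close>; the arrows are those arrows of
  the base category that commute with the actions, and they inherit the linear structure.
  The monoidal structure is the one making the forgetful functor strict monoidal.
\<close>

definition EM :: "('k, 'o, 'a, 'w) moncat_scheme \<Rightarrow> ('o, 'a, 't) opmonad_scheme \<Rightarrow> ('k, 'o \<times> 'a, 'a) moncat"
  where "EM W T = \<lparr>
    Obj = {(A, a). A \<in> Obj W \<and> a \<in> ob T A \<leadsto>\<^bsub>W\<^esub> A
      \<and> a \<cdot>\<^bsub>W\<^esub> mu T A = a \<cdot>\<^bsub>W\<^esub> ar T a \<and> a \<cdot>\<^bsub>W\<^esub> eta T A = idn W A},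
    Hom = (\<lambda>(A, a) (B, b). (Hom W A B)
      \<lparr>carrier := {f \<in> A \<leadsto>\<^bsub>W\<^esub> B. f \<cdot>\<^bsub>W\<^esub> a = b \<cdot>\<^bsub>W\<^esub> ar T f}\<rparr>),
    cmp = cmp W,
    idn = (\<lambda>(A, a). idn W A),
    tenso = (\<lambda>(A, a) (B, b). (A \<otimes>\<^sub>o\<^bsub>W\<^esub> B, (a \<otimes>\<^sub>a\<^bsub>W\<^esub> b) \<cdot>\<^bsub>W\<^esub> opm T A B)),
    tensa = tensa W,
    unito = (unito W, opu T),
    associator = (\<lambda>(A, a) (B, b) (D, d). associator W A B D),
    lunitor = (\<lambda>(A, a). lunitor W A),
    runitor = (\<lambda>(A, a). runitor W A)\<rparr>"

text \<open>The argument of \<open>EM_forget\<close> only serves to determine the type of objects.\<close>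

definition EM_forget :: "('k, 'o, 'a, 'w) moncat_scheme \<Rightarrow> ('o \<times> 'a, 'a, 'o, 'a) fctr"
  where "EM_forget W = \<lparr>ob = fst, ar = (\<lambda>f. f)\<rparr>"

definition EM_free :: "('o, 'a, 't) opmonad_scheme \<Rightarrow> ('o, 'a, 'o \<times> 'a, 'a) fctr"
  where "EM_free T = \<lparr>ob = (\<lambda>A. (ob T A, mu T A)), ar = ar T\<rparr>"

text \<open>
  The component of the counit of the free-forgetful adjunction at \<open>X = (A, a)\<close> is the action \<open>a\<close>,
  seen as an arrow of algebras from the free algebra \<open>(T A, \<mu>\<^sub>A)\<close> to \<open>X\<close>.
\<close>

definition EM_counit :: "'o \<times> 'a \<Rightarrow> 'a"
  where "EM_counit X = snd X"

lemma (in opmonoidal_monad) EM_counit_arr: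
  assumes "X \<in> Obj (EM W T)"
  shows "EM_counit X \<in> ob (EM_free T) (ob (EM_forget W) X) \<leadsto>\<^bsub>EM W T\<^esub> X"
  using assms by (auto simp: EM_def EM_counit_def EM_free_def EM_forget_def)

lemma (in opmonoidal_monad) EM_counit_natural:
  assumes "X \<in> Obj (EM W T)" "Y \<in> Obj (EM W T)" "f \<in> X \<leadsto>\<^bsub>EM W T\<^esub> Y"
  shows "EM_counit Y \<cdot>\<^bsub>EM W T\<^esub> ar (EM_free T) (ar (EM_forget W) f) = f \<cdot>\<^bsub>EM W T\<^esub> EM_counit X"
  using assms by (auto simp: EM_def EM_counit_def EM_free_def EM_forget_def)

lemma (in opmonoidal_monad) EM_counit_triangle_forget:
  assumes "X \<in> Obj (EM W T)"
  shows "ar (EM_forget W) (EM_counit X) \<cdot> eta T (ob (EM_forget W) X) = idn W (ob (EM_forget W) X)"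
  using assms by (auto simp: EM_def EM_counit_def EM_forget_def)

lemma (in opmonoidal_monad) EM_counit_triangle_free:
  assumes "A \<in> Obj W"
  shows "EM_counit (ob (EM_free T) A) \<cdot>\<^bsub>EM W T\<^esub> ar (EM_free T) (eta T A)
    = idn (EM W T) (ob (EM_free T) A)"
  using mu_eta_right[OF assms] by (simp add: EM_def EM_counit_def EM_free_def)


section \<open>Module categories and oplax module monads\<close>

text \<open>
  The data of a left action of a monoidal category on a category: the action on objects and arrows,
  and the coherence isomorphisms \<open>(X \<otimes> Y) \<rhd> V \<rightarrow> X \<rhd> (Y \<rhd> V)\<close> and \<open>1 \<rhd> V \<rightarrow> V\<close>.
\<close>

record ('p, 'b, 'o, 'a) action =
  acto :: "'p \<Rightarrow> 'o \<Rightarrow> 'o" (infixr "\<rhd>\<^sub>o\<index>" 75)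
  acta :: "'b \<Rightarrow> 'a \<Rightarrow> 'a" (infixr "\<rhd>\<^sub>a\<index>" 75)
  act_assoc :: "'p \<Rightarrow> 'p \<Rightarrow> 'o \<Rightarrow> 'a"
  act_unit :: "'o \<Rightarrow> 'a"

locale left_module_category =
  M: monoidal_category k M + C: linear_category k C
  for k :: "('k, 'r) ring_scheme"
    and M :: "('k, 'p, 'b, 'm) moncat_scheme"
    and C :: "('k, 'o, 'a, 'c) lincat_scheme" +
  fixes L :: "('p, 'b, 'o, 'a, 'l) action_scheme"
  assumes acto_Obj: "\<lbrakk>X \<in> Obj M; V \<in> Obj C\<rbrakk> \<Longrightarrow> X \<rhd>\<^sub>o\<^bsub>L\<^esub> V \<in> Obj C"
    and acta_arr: "\<lbrakk>X \<in> Obj M; X' \<in> Obj M; V \<in> Obj C; V' \<in> Obj C; f \<in> X \<leadsto>\<^bsub>M\<^esub> X'; g \<in> V \<leadsto>\<^bsub>C\<^esub> V'\<rbrakk>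
      \<Longrightarrow> f \<rhd>\<^sub>a\<^bsub>L\<^esub> g \<in> (X \<rhd>\<^sub>o\<^bsub>L\<^esub> V) \<leadsto>\<^bsub>C\<^esub> (X' \<rhd>\<^sub>o\<^bsub>L\<^esub> V')"
    and acta_idn: "\<lbrakk>X \<in> Obj M; V \<in> Obj C\<rbrakk> \<Longrightarrow> idn M X \<rhd>\<^sub>a\<^bsub>L\<^esub> idn C V = idn C (X \<rhd>\<^sub>o\<^bsub>L\<^esub> V)"
    and acta_cmp: "\<lbrakk>X \<in> Obj M; X' \<in> Obj M; X'' \<in> Obj M; V \<in> Obj C; V' \<in> Obj C; V'' \<in> Obj C;
        f \<in> X \<leadsto>\<^bsub>M\<^esub> X'; f' \<in> X' \<leadsto>\<^bsub>M\<^esub> X''; g \<in> V \<leadsto>\<^bsub>C\<^esub> V'; g' \<in> V' \<leadsto>\<^bsub>C\<^esub> V''\<rbrakk>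
      \<Longrightarrow> (f' \<cdot>\<^bsub>M\<^esub> f) \<rhd>\<^sub>a\<^bsub>L\<^esub> (g' \<cdot>\<^bsub>C\<^esub> g) = (f' \<rhd>\<^sub>a\<^bsub>L\<^esub> g') \<cdot>\<^bsub>C\<^esub> (f \<rhd>\<^sub>a\<^bsub>L\<^esub> g)"
    and acta_add_left: "\<lbrakk>X \<in> Obj M; X' \<in> Obj M; V \<in> Obj C; V' \<in> Obj C;
        f \<in> X \<leadsto>\<^bsub>M\<^esub> X'; f' \<in> X \<leadsto>\<^bsub>M\<^esub> X'; g \<in> V \<leadsto>\<^bsub>C\<^esub> V'\<rbrakk>
      \<Longrightarrow> (f \<oplus>\<^bsub>Hom M X X'\<^esub> f') \<rhd>\<^sub>a\<^bsub>L\<^esub> g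
        = (f \<rhd>\<^sub>a\<^bsub>L\<^esub> g) \<oplus>\<^bsub>Hom C (X \<rhd>\<^sub>o\<^bsub>L\<^esub> V) (X' \<rhd>\<^sub>o\<^bsub>L\<^esub> V')\<^esub> (f' \<rhd>\<^sub>a\<^bsub>L\<^esub> g)"
    and acta_add_right: "\<lbrakk>X \<in> Obj M; X' \<in> Obj M; V \<in> Obj C; V' \<in> Obj C;
        f \<in> X \<leadsto>\<^bsub>M\<^esub> X'; g \<in> V \<leadsto>\<^bsub>C\<^esub> V'; g' \<in> V \<leadsto>\<^bsub>C\<^esub> V'\<rbrakk>
      \<Longrightarrow> f \<rhd>\<^sub>a\<^bsub>L\<^esub> (g \<oplus>\<^bsub>Hom C V V'\<^esub> g')
        = (f \<rhd>\<^sub>a\<^bsub>L\<^esub> g) \<oplus>\<^bsub>Hom C (X \<rhd>\<^sub>o\<^bsub>L\<^esub> V) (X' \<rhd>\<^sub>o\<^bsub>L\<^esub> V')\<^esub> (f \<rhd>\<^sub>a\<^bsub>L\<^esub> g')"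
    and acta_smult_left: "\<lbrakk>X \<in> Obj M; X' \<in> Obj M; V \<in> Obj C; V' \<in> Obj C;
        f \<in> X \<leadsto>\<^bsub>M\<^esub> X'; g \<in> V \<leadsto>\<^bsub>C\<^esub> V'; c \<in> carrier k\<rbrakk>
      \<Longrightarrow> (c \<odot>\<^bsub>Hom M X X'\<^esub> f) \<rhd>\<^sub>a\<^bsub>L\<^esub> g
        = c \<odot>\<^bsub>Hom C (X \<rhd>\<^sub>o\<^bsub>L\<^esub> V) (X' \<rhd>\<^sub>o\<^bsub>L\<^esub> V')\<^esub> (f \<rhd>\<^sub>a\<^bsub>L\<^esub> g)"
    and acta_smult_right: "\<lbrakk>X \<in> Obj M; X' \<in> Obj M; V \<in> Obj C; V' \<in> Obj C;
        f \<in> X \<leadsto>\<^bsub>M\<^esub> X'; g \<in> V \<leadsto>\<^bsub>C\<^esub> V'; c \<in> carrier k\<rbrakk>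
      \<Longrightarrow> f \<rhd>\<^sub>a\<^bsub>L\<^esub> (c \<odot>\<^bsub>Hom C V V'\<^esub> g)
        = c \<odot>\<^bsub>Hom C (X \<rhd>\<^sub>o\<^bsub>L\<^esub> V) (X' \<rhd>\<^sub>o\<^bsub>L\<^esub> V')\<^esub> (f \<rhd>\<^sub>a\<^bsub>L\<^esub> g)"
    and act_assoc_iso: "\<lbrakk>X \<in> Obj M; Y \<in> Obj M; V \<in> Obj C\<rbrakk>
      \<Longrightarrow> iso_arrow C ((X \<otimes>\<^sub>o\<^bsub>M\<^esub> Y) \<rhd>\<^sub>o\<^bsub>L\<^esub> V) (X \<rhd>\<^sub>o\<^bsub>L\<^esub> (Y \<rhd>\<^sub>o\<^bsub>L\<^esub> V)) (act_assoc L X Y V)"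
    and act_assoc_natural: "\<lbrakk>X \<in> Obj M; X' \<in> Obj M; Y \<in> Obj M; Y' \<in> Obj M; V \<in> Obj C; V' \<in> Obj C;
        f \<in> X \<leadsto>\<^bsub>M\<^esub> X'; e \<in> Y \<leadsto>\<^bsub>M\<^esub> Y'; h \<in> V \<leadsto>\<^bsub>C\<^esub> V'\<rbrakk>
      \<Longrightarrow> act_assoc L X' Y' V' \<cdot>\<^bsub>C\<^esub> ((f \<otimes>\<^sub>a\<^bsub>M\<^esub> e) \<rhd>\<^sub>a\<^bsub>L\<^esub> h)
        = (f \<rhd>\<^sub>a\<^bsub>L\<^esub> (e \<rhd>\<^sub>a\<^bsub>L\<^esub> h)) \<cdot>\<^bsub>C\<^esub> act_assoc L X Y V"
    and act_unit_iso: "V \<in> Obj C \<Longrightarrow> iso_arrow C (unito M \<rhd>\<^sub>o\<^bsub>L\<^esub> V) V (act_unit L V)"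
    and act_unit_natural: "\<lbrakk>V \<in> Obj C; V' \<in> Obj C; g \<in> V \<leadsto>\<^bsub>C\<^esub> V'\<rbrakk>
      \<Longrightarrow> act_unit L V' \<cdot>\<^bsub>C\<^esub> (idn M (unito M) \<rhd>\<^sub>a\<^bsub>L\<^esub> g) = g \<cdot>\<^bsub>C\<^esub> act_unit L V"
    and act_pentagon: "\<lbrakk>X \<in> Obj M; Y \<in> Obj M; Z \<in> Obj M; V \<in> Obj C\<rbrakk>
      \<Longrightarrow> act_assoc L X Y (Z \<rhd>\<^sub>o\<^bsub>L\<^esub> V) \<cdot>\<^bsub>C\<^esub> act_assoc L (X \<otimes>\<^sub>o\<^bsub>M\<^esub> Y) Z V
        = (idn M X \<rhd>\<^sub>a\<^bsub>L\<^esub> act_assoc L Y Z V) \<cdot>\<^bsub>C\<^esub> act_assoc L X (Y \<otimes>\<^sub>o\<^bsub>M\<^esub> Z) V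
          \<cdot>\<^bsub>C\<^esub> (associator M X Y Z \<rhd>\<^sub>a\<^bsub>L\<^esub> idn C V)"
    and act_triangle: "\<lbrakk>X \<in> Obj M; V \<in> Obj C\<rbrakk>
      \<Longrightarrow> (idn M X \<rhd>\<^sub>a\<^bsub>L\<^esub> act_unit L V) \<cdot>\<^bsub>C\<^esub> act_assoc L X (unito M) V
        = runitor M X \<rhd>\<^sub>a\<^bsub>L\<^esub> idn C V"

text \<open>
  Oplax module endofunctors of the module category \<open>(C, L)\<close>, with coherence morphisms
  \<open>s X V : F (X \<rhd> V) \<rightarrow> X \<rhd> F V\<close>.
\<close>

locale oplax_module_functor =
  linear_functor k C C F + left_module_category k M C L
  for k :: "('k, 'r) ring_scheme"
    and M :: "('k, 'p, 'b, 'm) moncat_scheme"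
    and C :: "('k, 'o, 'a, 'c) lincat_scheme"
    and L :: "('p, 'b, 'o, 'a, 'l) action_scheme"
    and F :: "('o, 'a, 'o, 'a, 'f) fctr_scheme" +
  fixes s :: "'p \<Rightarrow> 'o \<Rightarrow> 'a"
  assumes s_arr: "\<lbrakk>X \<in> Obj M; V \<in> Obj C\<rbrakk>
      \<Longrightarrow> s X V \<in> ob F (X \<rhd>\<^sub>o\<^bsub>L\<^esub> V) \<leadsto>\<^bsub>C\<^esub> (X \<rhd>\<^sub>o\<^bsub>L\<^esub> ob F V)"
    and s_natural: "\<lbrakk>X \<in> Obj M; X' \<in> Obj M; V \<in> Obj C; V' \<in> Obj C; f \<in> X \<leadsto>\<^bsub>M\<^esub> X'; g \<in> V \<leadsto>\<^bsub>C\<^esub> V'\<rbrakk>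
      \<Longrightarrow> s X' V' \<cdot>\<^bsub>C\<^esub> ar F (f \<rhd>\<^sub>a\<^bsub>L\<^esub> g) = (f \<rhd>\<^sub>a\<^bsub>L\<^esub> ar F g) \<cdot>\<^bsub>C\<^esub> s X V"
    and s_assoc: "\<lbrakk>X \<in> Obj M; Y \<in> Obj M; V \<in> Obj C\<rbrakk>
      \<Longrightarrow> act_assoc L X Y (ob F V) \<cdot>\<^bsub>C\<^esub> s (X \<otimes>\<^sub>o\<^bsub>M\<^esub> Y) V
        = (idn M X \<rhd>\<^sub>a\<^bsub>L\<^esub> s Y V) \<cdot>\<^bsub>C\<^esub> s X (Y \<rhd>\<^sub>o\<^bsub>L\<^esub> V) \<cdot>\<^bsub>C\<^esub> ar F (act_assoc L X Y V)"
    and s_unit: "V \<in> Obj C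
      \<Longrightarrow> act_unit L (ob F V) \<cdot>\<^bsub>C\<^esub> s (unito M) V = ar F (act_unit L V)"

locale oplax_module_transformation =
  natural_transformation k C C F G \<sigma> +
  F: oplax_module_functor k M C L F s + G: oplax_module_functor k M C L G t
  for k :: "('k, 'r) ring_scheme"
    and M :: "('k, 'p, 'b, 'm) moncat_scheme"
    and C :: "('k, 'o, 'a, 'c) lincat_scheme"
    and L :: "('p, 'b, 'o, 'a, 'l) action_scheme"
    and F :: "('o, 'a, 'o, 'a, 'f) fctr_scheme"
    and s :: "'p \<Rightarrow> 'o \<Rightarrow> 'a"
    and G :: "('o, 'a, 'o, 'a, 'g) fctr_scheme"
    and t :: "'p \<Rightarrow> 'o \<Rightarrow> 'a"
    and \<sigma> :: "'o \<Rightarrow> 'a" +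
  assumes compatible: "\<lbrakk>X \<in> Obj M; V \<in> Obj C\<rbrakk>
      \<Longrightarrow> t X V \<cdot>\<^bsub>C\<^esub> \<sigma> (X \<rhd>\<^sub>o\<^bsub>L\<^esub> V) = (idn M X \<rhd>\<^sub>a\<^bsub>L\<^esub> \<sigma> V) \<cdot>\<^bsub>C\<^esub> s X V"

text \<open>
  An oplax module monad: a monad whose underlying functor is an oplax module functor and whose
  multiplication and unit are transformations of oplax module functors, where the composite
  \<open>T T\<close> and the identity functor carry the evident structures.
\<close>

locale oplax_module_monad =
  linear_monad k C T \<mu> \<eta> + oplax_module_functor k M C L T s
  for k :: "('k, 'r) ring_scheme"
    and M :: "('k, 'p, 'b, 'm) moncat_scheme"
    and C :: "('k, 'o, 'a, 'c) lincat_scheme"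
    and L :: "('p, 'b, 'o, 'a, 'l) action_scheme"
    and T :: "('o, 'a, 'o, 'a, 't) fctr_scheme"
    and \<mu> :: "'o \<Rightarrow> 'a" and \<eta> :: "'o \<Rightarrow> 'a"
    and s :: "'p \<Rightarrow> 'o \<Rightarrow> 'a" +
  assumes mu_module: "oplax_module_transformation k M C L
      (comp_fctr T T) (\<lambda>X V. s X (ob T V) \<cdot>\<^bsub>C\<^esub> ar T (s X V)) T s \<mu>"
    and eta_module: "oplax_module_transformation k M C L
      id_fctr (\<lambda>X V. idn C (X \<rhd>\<^sub>o\<^bsub>L\<^esub> V)) T s \<eta>"

locale strong_module_monad = oplax_module_monad +
  assumes s_iso: "\<lbrakk>X \<in> Obj M; V \<in> Obj C\<rbrakk>
    \<Longrightarrow> iso_arrow C (ob T (X \<rhd>\<^sub>o\<^bsub>L\<^esub> V)) (X \<rhd>\<^sub>o\<^bsub>L\<^esub> ob T V) (s X V)"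


section \<open>The canonical module structure of an opmonoidal monad\<close>

definition EM_action :: "('k, 'o, 'a, 'w) moncat_scheme \<Rightarrow> ('o \<times> 'a, 'a, 'o, 'a) action"
  where "EM_action W = \<lparr>
    acto = (\<lambda>X V. ob (EM_forget W) X \<otimes>\<^sub>o\<^bsub>W\<^esub> V),
    acta = (\<lambda>f g. ar (EM_forget W) f \<otimes>\<^sub>a\<^bsub>W\<^esub> g),
    act_assoc = (\<lambda>X Y V. associator W (ob (EM_forget W) X) (ob (EM_forget W) Y) V),
    act_unit = lunitor W\<rparr>"

definition canonical_oplax ::
    "('k, 'o, 'a, 'w) moncat_scheme \<Rightarrow> ('o, 'a, 't) opmonad_scheme \<Rightarrow> 'o \<times> 'a \<Rightarrow> 'o \<Rightarrow> 'a"
  where "canonical_oplax W T X V =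
    (ar (EM_forget W) (EM_counit X) \<otimes>\<^sub>a\<^bsub>W\<^esub> idn W (ob T V)) \<cdot>\<^bsub>W\<^esub> opm T (ob (EM_forget W) X) V"

definition canonical_oplax_invertible ::
    "('k, 'o, 'a, 'w) moncat_scheme \<Rightarrow> ('o, 'a, 't) opmonad_scheme \<Rightarrow> bool"
  where "canonical_oplax_invertible W T \<longleftrightarrow> (\<forall>X \<in> Obj (EM W T). \<forall>V \<in> Obj W.
    iso_arrow W (ob T (X \<rhd>\<^sub>o\<^bsub>EM_action W\<^esub> V)) (X \<rhd>\<^sub>o\<^bsub>EM_action W\<^esub> ob T V)
      (canonical_oplax W T X V))"

end

theory Submission
  imports Defs
begin

text \<open>
  The fusion operator at \<open>V, W\<close> is the coherence morphism at the free algebra on \<open>V\<close>. Conversely, an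
  algebra \<open>(A, a)\<close> is the coequalizer of the morphisms \<open>\<mu>\<^sub>A, T a : T T A \<rightarrow> T A\<close> of free algebras, and
  in the base category this coequalizer is split by \<open>\<eta>\<^sub>A\<close> and \<open>\<eta>\<^bsub>T A\<^esub>\<close>. These are not
  algebra morphisms, so the coherence morphisms need not commute with them; but split coequalizers are
  preserved by \<open>T (- \<otimes> W)\<close> and \<open>- \<otimes> T W\<close>, hence invertibility passes from free algebras to \<open>(A, a)\<close>.

  The tensor product of two actions and the coherence morphisms both have the form
  \<open>(a \<otimes> b) \<cdot> T\<^sub>m\<close>; all coherence laws of the Eilenberg--Moore category and of its action reduce to
  a few identities for such composites.
\<close>

section \<open>Typed arrows\<close>

text \<open>Hom-spaces are unconstrained outside the set of objects, so membership in one does not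
  make its indices objects. Bundling both facts lets typing derivations be chained with
  \<open>OF\<close>.\<close>

definition arrow :: "('k, 'o, 'a, 'z) lincat_scheme \<Rightarrow> 'a \<Rightarrow> 'o \<Rightarrow> 'o \<Rightarrow> bool"
  where "arrow C f A B \<longleftrightarrow> A \<in> Obj C \<and> B \<in> Obj C \<and> f \<in> A \<leadsto>\<^bsub>C\<^esub> B"

lemma arrowI: "\<lbrakk>A \<in> Obj C; B \<in> Obj C; f \<in> A \<leadsto>\<^bsub>C\<^esub> B\<rbrakk> \<Longrightarrow> arrow C f A B"
  by (simp add: arrow_def)

lemma arrowD:
  assumes "arrow C f A B"
  shows "A \<in> Obj C" "B \<in> Obj C" "f \<in> A \<leadsto>\<^bsub>C\<^esub> B"
  using assms by (simp_all add: arrow_def)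

section \<open>Calculus of composites of typed arrows\<close>

context linear_category
begin

lemma arrow_idn: "A \<in> Obj C \<Longrightarrow> arrow C (idn C A) A A"
  by (simp add: arrow_def idn_arr)

lemma arrow_cmp: "\<lbrakk>arrow C f A B; arrow C g B D\<rbrakk> \<Longrightarrow> arrow C (g \<cdot> f) A D"
  using cmp_arr by (auto simp: arrow_def)

lemma arrow_cmp_idn: "arrow C f A B \<Longrightarrow> f \<cdot> idn C A = f"
  using cmp_idn by (auto simp: arrow_def)

lemma arrow_idn_cmp: "arrow C f A B \<Longrightarrow> idn C B \<cdot> f = f"
  using idn_cmp by (auto simp: arrow_def)

lemma arrow_assoc:
  "\<lbrakk>arrow C f A B; arrow C g B D; arrow C h D E\<rbrakk> \<Longrightarrow> (h \<cdot> g) \<cdot> f = h \<cdot> (g \<cdot> f)"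
  by (simp add: arrow_def cmp_assoc[of A B D E])

text \<open>Composites nest to the right, so \<open>p \<cdot> q\<close> is not a subterm once an
  arrow \<open>x\<close> precedes it. This form makes a commuting square usable inside longer
  composites.\<close>

lemma arrow_square:
  assumes x: "arrow C x A B" and q: "arrow C q B D" and p: "arrow C p D E"
    and s: "arrow C s B D'" and r: "arrow C r D' E" and eq: "p \<cdot> q = r \<cdot> s"
  shows "p \<cdot> (q \<cdot> x) = r \<cdot> (s \<cdot> x)"
  using arrow_assoc[OF x q p] arrow_assoc[OF x s r] eq by simp

lemma arrow_retract:
  assumes "arrow C f A B" "arrow C s B D" "arrow C p D B" "p \<cdot> s = idn C B"
  shows "p \<cdot> (s \<cdot> f) = f"
  using arrow_assoc[OF assms(1-3)] assms(4) arrow_idn_cmp[OF assms(1)] by simp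

text \<open>Insert \<open>c2 \<cdot> g2\<close> after \<open>d'\<close>, cross the square, and
  cancel \<open>g1 \<cdot> c1\<close>. This serves both for inverses of coherence morphisms and for
  inverses of algebra morphisms.\<close>

lemma inverse_square:
  assumes c1: "arrow C c1 A1 B1" and g1: "arrow C g1 B1 A1" and gc1: "g1 \<cdot> c1 = idn C A1"
    and c2: "arrow C c2 A2 B2" and g2: "arrow C g2 B2 A2" and cg2: "c2 \<cdot> g2 = idn C B2"
    and d: "arrow C d A2 A1" and d': "arrow C d' B2 B1" and sq: "c1 \<cdot> d = d' \<cdot> c2"
  shows "g1 \<cdot> d' = d \<cdot> g2"
proof -
  have "g1 \<cdot> d' = g1 \<cdot> (d' \<cdot> (c2 \<cdot> g2))"
    using arrow_cmp_idn[OF d'] cg2 by simp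
  also have "\<dots> = g1 \<cdot> (c1 \<cdot> (d \<cdot> g2))"
    using arrow_square[OF g2 c2 d' d c1 sq[symmetric]] by simp
  also have "\<dots> = d \<cdot> g2"
    by (rule arrow_retract[OF arrow_cmp[OF g2 d] c1 g1 gc1])
  finally show ?thesis .
qed

lemma iso_arrowI:
  assumes "arrow C f A B" "arrow C g B A" "g \<cdot> f = idn C A" "f \<cdot> g = idn C B"
  shows "iso_arrow C A B f"
  using assms by (auto simp: iso_arrow_def arrow_def)

end

lemma iso_arrowE:
  assumes "iso_arrow C A B f" "A \<in> Obj C" "B \<in> Obj C"
  obtains g where "arrow C f A B" "arrow C g B A"
    "g \<cdot>\<^bsub>C\<^esub> f = idn C A" "f \<cdot>\<^bsub>C\<^esub> g = idn C B"
  using assms by (auto simp: iso_arrow_def arrow_def)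

text \<open>Two rows \<open>A2 => A1 -> A0\<close> and \<open>B2 => B1 -> B0\<close> are compared by
  \<open>c2\<close>, \<open>c1\<close>, \<open>c0\<close>. The splitting \<open>s\<close>,
  \<open>t\<close> of the lower row produces the inverse of \<open>c0\<close>; on the upper row
  \<open>e\<close> makes \<open>p\<close> epic. The commuting squares involve \<open>p\<close>,
  \<open>d\<close> and \<open>h\<close>, never the sections.\<close>

lemma (in linear_category) iso_arrow_split_coequalizer:
  assumes p: "arrow C p A1 A0" and e: "arrow C e A0 A1" and pe: "p \<cdot> e = idn C A0"
    and d: "arrow C d A2 A1" and h: "arrow C h A2 A1" and pd: "p \<cdot> d = p \<cdot> h"
    and p': "arrow C p' B1 B0" and s: "arrow C s B0 B1" and ps: "p' \<cdot> s = idn C B0"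
    and d': "arrow C d' B2 B1" and t: "arrow C t B1 B2" and dt: "d' \<cdot> t = idn C B1"
    and h': "arrow C h' B2 B1" and ht: "h' \<cdot> t = s \<cdot> p'"
    and c0: "arrow C c0 A0 B0" and c1: "iso_arrow C A1 B1 c1" and c2: "iso_arrow C A2 B2 c2"
    and nat_p: "c0 \<cdot> p = p' \<cdot> c1" and nat_d: "c1 \<cdot> d = d' \<cdot> c2" and nat_h: "c1 \<cdot> h = h' \<cdot> c2"
  shows "iso_arrow C A0 B0 c0"
proof -
  obtain g1 where c1: "arrow C c1 A1 B1" and g1: "arrow C g1 B1 A1"
    and gc1: "g1 \<cdot> c1 = idn C A1" and cg1: "c1 \<cdot> g1 = idn C B1"
    using iso_arrowE[OF c1 arrowD(1)[OF p] arrowD(1)[OF p']] .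
  obtain g2 where c2: "arrow C c2 A2 B2" and g2: "arrow C g2 B2 A2"
    and gc2: "g2 \<cdot> c2 = idn C A2" and cg2: "c2 \<cdot> g2 = idn C B2"
    using iso_arrowE[OF c2 arrowD(1)[OF d] arrowD(1)[OF d']] .
  note gd = inverse_square[OF c1 g1 gc1 c2 g2 cg2 d d' nat_d]
  note gh = inverse_square[OF c1 g1 gc1 c2 g2 cg2 h h' nat_h]
  \<comment> \<open>Candidate inverse: lift along \<open>s\<close>, invert \<open>c1\<close>,
    project along \<open>p\<close>.\<close>
  define K where "K = p \<cdot> g1 \<cdot> s"
  note gs = arrow_cmp[OF s g1] and tc = arrow_cmp[OF c1 t]
  have K: "arrow C K B0 A0"
    unfolding K_def by (rule arrow_cmp[OF gs p])
  have "c0 \<cdot> K = p' \<cdot> c1 \<cdot> g1 \<cdot> s"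
    unfolding K_def by (rule arrow_square[OF gs p c0 c1 p' nat_p])
  also have "\<dots> = idn C B0"
    by (simp add: arrow_retract[OF s g1 c1 cg1] ps)
  finally have cK: "c0 \<cdot> K = idn C B0" .
  have "(K \<cdot> c0) \<cdot> p = K \<cdot> (p' \<cdot> c1)"
    using arrow_assoc[OF p c0 K] nat_p by simp
  also have "\<dots> = p \<cdot> g1 \<cdot> s \<cdot> p' \<cdot> c1"
    unfolding K_def using arrow_assoc[OF arrow_cmp[OF c1 p'] gs p]
      arrow_assoc[OF arrow_cmp[OF c1 p'] s g1] by simp
  \<comment> \<open>The splitting trades \<open>s \<cdot> p'\<close> for
    \<open>h' \<cdot> t\<close>. Moving \<open>g1\<close> past \<open>h'\<close> exposes
    \<open>p \<cdot> h\<close>, which is replaced with \<open>p \<cdot> d\<close>; after moving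
    back, \<open>d' \<cdot> t\<close> and \<open>g1 \<cdot> c1\<close> cancel.\<close>
  also have "\<dots> = p \<cdot> g1 \<cdot> h' \<cdot> t \<cdot> c1"
    by (simp add: arrow_square[OF c1 p' s t h' ht[symmetric]])
  also have "\<dots> = p \<cdot> h \<cdot> g2 \<cdot> t \<cdot> c1"
    by (simp add: arrow_square[OF tc h' g1 g2 h gh])
  also have "\<dots> = p \<cdot> d \<cdot> g2 \<cdot> t \<cdot> c1"
    by (rule arrow_square[OF arrow_cmp[OF tc g2] h p d p pd[symmetric]])
  also have "\<dots> = p \<cdot> g1 \<cdot> d' \<cdot> t \<cdot> c1"
    by (simp add: arrow_square[OF tc d' g1 g2 d gd])
  also have "\<dots> = p"
    by (simp add: arrow_retract[OF c1 t d' dt] gc1 arrow_cmp_idn[OF p])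
  finally have "(K \<cdot> c0) \<cdot> p = p" .
  \<comment> \<open>\<open>p\<close> has the right inverse \<open>e\<close>, so it may be cancelled
    from \<open>(K \<cdot> c0) \<cdot> p = p\<close>.\<close>
  hence Kc: "K \<cdot> c0 = idn C A0"
    using arrow_assoc[OF e p arrow_cmp[OF c0 K]] pe arrow_cmp_idn[OF arrow_cmp[OF c0 K]] by simp
  show ?thesis
    by (rule iso_arrowI[OF c0 K Kc cK])
qed

section \<open>Typed arrows under tensor products and functors\<close>

lemma (in monoidal_category) arrow_tensa:
  "\<lbrakk>arrow C f A A'; arrow C g B B'\<rbrakk> \<Longrightarrow> arrow C (f \<otimes>\<^sub>a g) (A \<otimes>\<^sub>o B) (A' \<otimes>\<^sub>o B')"
  by (simp add: arrow_def tensa_arr tenso_Obj)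

lemma (in monoidal_category) arrow_tensa_cmp:
  "\<lbrakk>arrow C f A A'; arrow C f' A' A''; arrow C g B B'; arrow C g' B' B''\<rbrakk>
    \<Longrightarrow> (f' \<otimes>\<^sub>a g') \<cdot> (f \<otimes>\<^sub>a g) = (f' \<cdot> f) \<otimes>\<^sub>a (g' \<cdot> g)"
  by (simp add: arrow_def tensa_cmp[of A A' A'' B B' B''])

lemma (in monoidal_category) arrow_coherence:
  "\<lbrakk>A \<in> Obj C; B \<in> Obj C; D \<in> Obj C\<rbrakk>
    \<Longrightarrow> arrow C (associator C A B D) ((A \<otimes>\<^sub>o B) \<otimes>\<^sub>o D) (A \<otimes>\<^sub>o (B \<otimes>\<^sub>o D))"
  "A \<in> Obj C \<Longrightarrow> arrow C (lunitor C A) (unito C \<otimes>\<^sub>o A) A"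
  "A \<in> Obj C \<Longrightarrow> arrow C (runitor C A) (A \<otimes>\<^sub>o unito C) A"
  using associator_iso lunitor_iso runitor_iso
  by (auto simp: arrow_def iso_arrow_def tenso_Obj unito_Obj)

context linear_functor
begin

lemma arrow_ar: "arrow C f A B \<Longrightarrow> arrow D (ar F f) (ob F A) (ob F B)"
  by (simp add: arrow_def ob_Obj ar_arr)

lemma arrow_ar_cmp:
  "\<lbrakk>arrow C f A B; arrow C g B E\<rbrakk> \<Longrightarrow> ar F (g \<cdot>\<^bsub>C\<^esub> f) = ar F g \<cdot>\<^bsub>D\<^esub> ar F f"
  by (simp add: arrow_def ar_cmp[of A B E])

end


section \<open>Comparison morphisms followed by a tensor product\<close>

text \<open>For \<open>F = T\<close>, two actions \<open>a\<close>, \<open>b\<close> give the action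
  on the tensor product of algebras; an action \<open>a\<close> and an identity \<open>b\<close>
  give the canonical coherence morphism. The objects are arguments because \<open>opm\<close>
  depends on them and arrows do not record their sources.\<close>

definition opm_tensor ::
    "('k, 'p, 'b, 'd) moncat_scheme \<Rightarrow> ('o, 'a, 'p, 'b, 'f) opfctr_scheme
      \<Rightarrow> 'b \<Rightarrow> 'b \<Rightarrow> 'o \<Rightarrow> 'o \<Rightarrow> 'b"
  where "opm_tensor D F a b A B = (a \<otimes>\<^sub>a\<^bsub>D\<^esub> b) \<cdot>\<^bsub>D\<^esub> opm F A B"

context opmonoidal_functor
begin

lemma arrow_opm:
  "\<lbrakk>A \<in> Obj C; B \<in> Obj C\<rbrakk>
    \<Longrightarrow> arrow D (opm F A B) (ob F (A \<otimes>\<^sub>o\<^bsub>C\<^esub> B)) (ob F A \<otimes>\<^sub>o\<^bsub>D\<^esub> ob F B)"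
  by (simp add: arrow_def opm_arr ob_Obj C.tenso_Obj D.tenso_Obj)

lemma arrow_opu: "arrow D (opu F) (ob F (unito C)) (unito D)"
  by (simp add: arrow_def opu_arr ob_Obj C.unito_Obj D.unito_Obj)

lemma arrow_opm_tensor:
  assumes "A \<in> Obj C" "B \<in> Obj C" "arrow D a (ob F A) P" "arrow D b (ob F B) Q"
  shows "arrow D (opm_tensor D F a b A B) (ob F (A \<otimes>\<^sub>o\<^bsub>C\<^esub> B)) (P \<otimes>\<^sub>o\<^bsub>D\<^esub> Q)"
  unfolding opm_tensor_def
  by (rule D.arrow_cmp[OF arrow_opm D.arrow_tensa]) (use assms in auto)

lemma tensa_opm_tensor:
  assumes "A \<in> Obj C" "B \<in> Obj C" and a: "arrow D a (ob F A) P" and b: "arrow D b (ob F B) Q"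
    and f: "arrow D f P P'" and g: "arrow D g Q Q'"
  shows "(f \<otimes>\<^sub>a\<^bsub>D\<^esub> g) \<cdot>\<^bsub>D\<^esub> opm_tensor D F a b A B
    = opm_tensor D F (f \<cdot>\<^bsub>D\<^esub> a) (g \<cdot>\<^bsub>D\<^esub> b) A B"
  using D.arrow_assoc[OF arrow_opm[OF assms(1,2)] D.arrow_tensa[OF a b] D.arrow_tensa[OF f g]]
  by (simp add: opm_tensor_def D.arrow_tensa_cmp[OF a f b g])

text \<open>Naturality of \<open>opm\<close> moves the tensor product out of \<open>F\<close>, and
  the interchange law absorbs it. Together with \<open>tensa_opm_tensor\<close> this yields the
  naturality squares for tensored actions and for coherence morphisms.\<close>

lemma opm_tensor_ar_tensa:
  assumes f: "arrow C f A A'" and g: "arrow C g B B'"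
    and a: "arrow D a (ob F A') P" and b: "arrow D b (ob F B') Q"
  shows "opm_tensor D F a b A' B' \<cdot>\<^bsub>D\<^esub> ar F (f \<otimes>\<^sub>a\<^bsub>C\<^esub> g)
    = opm_tensor D F (a \<cdot>\<^bsub>D\<^esub> ar F f) (b \<cdot>\<^bsub>D\<^esub> ar F g) A B"
proof -
  note Obj = arrowD(1,2)[OF f] arrowD(1,2)[OF g]
  have "opm_tensor D F a b A' B' \<cdot>\<^bsub>D\<^esub> ar F (f \<otimes>\<^sub>a\<^bsub>C\<^esub> g)
      = (a \<otimes>\<^sub>a\<^bsub>D\<^esub> b) \<cdot>\<^bsub>D\<^esub> opm F A' B' \<cdot>\<^bsub>D\<^esub> ar F (f \<otimes>\<^sub>a\<^bsub>C\<^esub> g)"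
    unfolding opm_tensor_def
    by (rule D.arrow_assoc[OF arrow_ar[OF C.arrow_tensa[OF f g]] arrow_opm D.arrow_tensa[OF a b]])
      (use Obj in auto)
  also have "\<dots> = (a \<otimes>\<^sub>a\<^bsub>D\<^esub> b) \<cdot>\<^bsub>D\<^esub> opm_tensor D F (ar F f) (ar F g) A B"
    using opm_natural[OF Obj arrowD(3)[OF f] arrowD(3)[OF g]] by (simp add: opm_tensor_def)
  also have "\<dots> = opm_tensor D F (a \<cdot>\<^bsub>D\<^esub> ar F f) (b \<cdot>\<^bsub>D\<^esub> ar F g) A B"
    by (rule tensa_opm_tensor[OF Obj(1,3) arrow_ar[OF f] arrow_ar[OF g] a b])
  finally show ?thesis .
qed

text \<open>Coassociativity of \<open>F\<close>, transported along \<open>a\<close>,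
  \<open>b\<close>, \<open>e\<close> by naturality of the associator. With three actions it makes
  the associator an algebra morphism; with \<open>e\<close> an identity it gives the associativity
  law of the coherence morphisms.\<close>

lemma associator_opm_tensor:
  assumes Obj: "A \<in> Obj C" "B \<in> Obj C" "E \<in> Obj C"
    and a: "arrow D a (ob F A) P" and b: "arrow D b (ob F B) Q" and e: "arrow D e (ob F E) R"
  shows "associator D P Q R \<cdot>\<^bsub>D\<^esub> opm_tensor D F (opm_tensor D F a b A B) e (A \<otimes>\<^sub>o\<^bsub>C\<^esub> B) E
    = opm_tensor D F a (opm_tensor D F b e B E) A (B \<otimes>\<^sub>o\<^bsub>C\<^esub> E) \<cdot>\<^bsub>D\<^esub> ar F (associator C A B E)"
proof -
  note [simp] = ob_Obj C.tenso_Obj D.tenso_Obj C.unito_Obj D.unito_Obj Obj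
    arrowD(2)[OF a] arrowD(2)[OF b] arrowD(2)[OF e]
  note m = arrow_opm[OF Obj(1,2)] and m' = arrow_opm[OF C.tenso_Obj[OF Obj(1,2)] Obj(3)]
  note n = arrow_opm[OF Obj(2,3)] and n' = arrow_opm[OF Obj(1) C.tenso_Obj[OF Obj(2,3)]]
  note iA = D.arrow_idn[OF ob_Obj[OF Obj(1)]] and iE = D.arrow_idn[OF ob_Obj[OF Obj(3)]]
  note ab = D.arrow_tensa[OF a b] and be = D.arrow_tensa[OF b e]
  note ab_e = D.arrow_tensa[OF ab e] and a_be = D.arrow_tensa[OF a be]
  note \<alpha> = D.arrow_coherence(1)[of P Q R] D.arrow_coherence(1)[of "ob F A" "ob F B" "ob F E"]
  note \<beta> = arrow_ar[OF C.arrow_coherence(1)[OF Obj]]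
  \<comment> \<open>On each side \<open>a\<close>, \<open>b\<close>, \<open>e\<close> are split off
    as an outer tensor product. What remains is built from comparison morphisms and identities
    alone, where \<open>op_coassociative\<close> applies.\<close>
  have l: "opm_tensor D F (opm_tensor D F a b A B) e (A \<otimes>\<^sub>o\<^bsub>C\<^esub> B) E
      = ((a \<otimes>\<^sub>a\<^bsub>D\<^esub> b) \<otimes>\<^sub>a\<^bsub>D\<^esub> e) \<cdot>\<^bsub>D\<^esub> opm_tensor D F (opm F A B) (idn D (ob F E)) (A \<otimes>\<^sub>o\<^bsub>C\<^esub> B) E"
    by (simp add: tensa_opm_tensor[OF _ _ m iE ab e] D.arrow_cmp_idn[OF e])
      (simp add: opm_tensor_def)
  have r: "opm_tensor D F a (opm_tensor D F b e B E) A (B \<otimes>\<^sub>o\<^bsub>C\<^esub> E)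
      = (a \<otimes>\<^sub>a\<^bsub>D\<^esub> (b \<otimes>\<^sub>a\<^bsub>D\<^esub> e)) \<cdot>\<^bsub>D\<^esub> opm_tensor D F (idn D (ob F A)) (opm F B E) A (B \<otimes>\<^sub>o\<^bsub>C\<^esub> E)"
    by (simp add: tensa_opm_tensor[OF _ _ iA n a be] D.arrow_cmp_idn[OF a])
      (simp add: opm_tensor_def)
  have tl: "arrow D (opm_tensor D F (opm F A B) (idn D (ob F E)) (A \<otimes>\<^sub>o\<^bsub>C\<^esub> B) E)
      (ob F ((A \<otimes>\<^sub>o\<^bsub>C\<^esub> B) \<otimes>\<^sub>o\<^bsub>C\<^esub> E)) ((ob F A \<otimes>\<^sub>o\<^bsub>D\<^esub> ob F B) \<otimes>\<^sub>o\<^bsub>D\<^esub> ob F E)"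
    by (rule arrow_opm_tensor[OF _ _ m iE]) auto
  have tr: "arrow D (opm_tensor D F (idn D (ob F A)) (opm F B E) A (B \<otimes>\<^sub>o\<^bsub>C\<^esub> E))
      (ob F (A \<otimes>\<^sub>o\<^bsub>C\<^esub> (B \<otimes>\<^sub>o\<^bsub>C\<^esub> E))) (ob F A \<otimes>\<^sub>o\<^bsub>D\<^esub> (ob F B \<otimes>\<^sub>o\<^bsub>D\<^esub> ob F E))"
    by (rule arrow_opm_tensor[OF _ _ iA n]) auto
  have coassoc: "associator D (ob F A) (ob F B) (ob F E)
        \<cdot>\<^bsub>D\<^esub> opm_tensor D F (opm F A B) (idn D (ob F E)) (A \<otimes>\<^sub>o\<^bsub>C\<^esub> B) E
      = opm_tensor D F (idn D (ob F A)) (opm F B E) A (B \<otimes>\<^sub>o\<^bsub>C\<^esub> E) \<cdot>\<^bsub>D\<^esub> ar F (associator C A B E)"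
    using op_coassociative[OF Obj] D.arrow_assoc[OF \<beta> n' D.arrow_tensa[OF iA n]]
    by (simp add: opm_tensor_def)
  have nat: "associator D P Q R \<cdot>\<^bsub>D\<^esub> ((a \<otimes>\<^sub>a\<^bsub>D\<^esub> b) \<otimes>\<^sub>a\<^bsub>D\<^esub> e)
      = (a \<otimes>\<^sub>a\<^bsub>D\<^esub> (b \<otimes>\<^sub>a\<^bsub>D\<^esub> e)) \<cdot>\<^bsub>D\<^esub> associator D (ob F A) (ob F B) (ob F E)"
    by (rule D.associator_natural) (use a b e in \<open>auto dest: arrowD\<close>)
  show ?thesis
    unfolding l r
    using D.arrow_assoc[OF tl ab_e \<alpha>(1)] D.arrow_assoc[OF tl \<alpha>(2) a_be]
      D.arrow_assoc[OF \<beta> tr a_be]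
    by (simp add: nat coassoc)
qed

text \<open>Left counitality combined with naturality of the left unitor. It makes the unitor an
  algebra morphism when \<open>a\<close> is an action, and gives the unit law of the coherence
  morphisms when \<open>a\<close> is an identity.\<close>

lemma lunitor_opm_tensor:
  assumes A: "A \<in> Obj C" and a: "arrow D a (ob F A) P"
  shows "lunitor D P \<cdot>\<^bsub>D\<^esub> opm_tensor D F (opu F) a (unito C) A = a \<cdot>\<^bsub>D\<^esub> ar F (lunitor C A)"
proof -
  note iA = D.arrow_idn[OF ob_Obj[OF A]] and iu = D.arrow_idn[OF D.unito_Obj]
  note t = arrow_opm_tensor[OF C.unito_Obj A arrow_opu iA]
  have "lunitor D P \<cdot>\<^bsub>D\<^esub> opm_tensor D F (opu F) a (unito C) A
      = lunitor D P \<cdot>\<^bsub>D\<^esub> (idn D (unito D) \<otimes>\<^sub>a\<^bsub>D\<^esub> a)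
        \<cdot>\<^bsub>D\<^esub> opm_tensor D F (opu F) (idn D (ob F A)) (unito C) A"
    by (simp add: tensa_opm_tensor[OF C.unito_Obj A arrow_opu iA iu a]
        D.arrow_cmp_idn[OF a] D.arrow_idn_cmp[OF arrow_opu])
  also have "\<dots> = (lunitor D P \<cdot>\<^bsub>D\<^esub> (idn D (unito D) \<otimes>\<^sub>a\<^bsub>D\<^esub> a))
        \<cdot>\<^bsub>D\<^esub> opm_tensor D F (opu F) (idn D (ob F A)) (unito C) A"
    by (rule D.arrow_assoc[OF t D.arrow_tensa[OF iu a] D.arrow_coherence(2), symmetric])
      (rule arrowD(2)[OF a])
  also have "\<dots> = (a \<cdot>\<^bsub>D\<^esub> lunitor D (ob F A))
        \<cdot>\<^bsub>D\<^esub> opm_tensor D F (opu F) (idn D (ob F A)) (unito C) A"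
    using D.lunitor_natural[OF arrowD[OF a]] by simp
  also have "\<dots> = a \<cdot>\<^bsub>D\<^esub> lunitor D (ob F A)
        \<cdot>\<^bsub>D\<^esub> opm_tensor D F (opu F) (idn D (ob F A)) (unito C) A"
    by (rule D.arrow_assoc[OF t D.arrow_coherence(2)[OF ob_Obj[OF A]] a])
  also have "\<dots> = a \<cdot>\<^bsub>D\<^esub> ar F (lunitor C A)"
    using op_counital_left[OF A] by (simp add: opm_tensor_def)
  finally show ?thesis .
qed

lemma runitor_opm_tensor:
  assumes A: "A \<in> Obj C" and a: "arrow D a (ob F A) P"
  shows "runitor D P \<cdot>\<^bsub>D\<^esub> opm_tensor D F a (opu F) A (unito C) = a \<cdot>\<^bsub>D\<^esub> ar F (runitor C A)"
proof -
  note iA = D.arrow_idn[OF ob_Obj[OF A]] and iu = D.arrow_idn[OF D.unito_Obj]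
  note t = arrow_opm_tensor[OF A C.unito_Obj iA arrow_opu]
  have "runitor D P \<cdot>\<^bsub>D\<^esub> opm_tensor D F a (opu F) A (unito C)
      = runitor D P \<cdot>\<^bsub>D\<^esub> (a \<otimes>\<^sub>a\<^bsub>D\<^esub> idn D (unito D))
        \<cdot>\<^bsub>D\<^esub> opm_tensor D F (idn D (ob F A)) (opu F) A (unito C)"
    by (simp add: tensa_opm_tensor[OF A C.unito_Obj iA arrow_opu a iu]
        D.arrow_cmp_idn[OF a] D.arrow_idn_cmp[OF arrow_opu])
  also have "\<dots> = (runitor D P \<cdot>\<^bsub>D\<^esub> (a \<otimes>\<^sub>a\<^bsub>D\<^esub> idn D (unito D)))
        \<cdot>\<^bsub>D\<^esub> opm_tensor D F (idn D (ob F A)) (opu F) A (unito C)"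
    by (rule D.arrow_assoc[OF t D.arrow_tensa[OF a iu] D.arrow_coherence(3), symmetric])
      (rule arrowD(2)[OF a])
  also have "\<dots> = (a \<cdot>\<^bsub>D\<^esub> runitor D (ob F A))
        \<cdot>\<^bsub>D\<^esub> opm_tensor D F (idn D (ob F A)) (opu F) A (unito C)"
    using D.runitor_natural[OF arrowD[OF a]] by simp
  also have "\<dots> = a \<cdot>\<^bsub>D\<^esub> runitor D (ob F A)
        \<cdot>\<^bsub>D\<^esub> opm_tensor D F (idn D (ob F A)) (opu F) A (unito C)"
    by (rule D.arrow_assoc[OF t D.arrow_coherence(3)[OF ob_Obj[OF A]] a])
  also have "\<dots> = a \<cdot>\<^bsub>D\<^esub> ar F (runitor C A)"
    using op_counital_right[OF A] by (simp add: opm_tensor_def)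
  finally show ?thesis .
qed

end

section \<open>Comparison morphisms against the multiplication and unit of the monad\<close>

context opmonoidal_monad
begin

lemma arrow_mu: "A \<in> Obj W \<Longrightarrow> arrow W (mu T A) (ob T (ob T A)) (ob T A)"
  using natural_transformation.component[OF mu_natural]
  by (auto simp: arrow_def ob_Obj comp_fctr_def)

lemma arrow_eta: "A \<in> Obj W \<Longrightarrow> arrow W (eta T A) A (ob T A)"
  using natural_transformation.component[OF eta_natural]
  by (auto simp: arrow_def ob_Obj id_fctr_def)

lemma arrow_mu_natural: "arrow W f A B \<Longrightarrow> mu T B \<cdot> ar T (ar T f) = ar T f \<cdot> mu T A"
  using natural_transformation.natural[OF mu_natural] by (auto simp: arrow_def comp_fctr_def)

lemma arrow_eta_natural: "arrow W f A B \<Longrightarrow> eta T B \<cdot> f = ar T f \<cdot> eta T A"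
  using natural_transformation.natural[OF eta_natural] by (auto simp: arrow_def id_fctr_def)

text \<open>The comparison morphism of the composite \<open>T T\<close> is
  \<open>opm T (ob T A) (ob T B) \<cdot> ar T (opm T A B)\<close>. Its outer part joins the tensor
  product of multiplications, and the inner part stays under \<open>T\<close>.\<close>

lemma opm_mu:
  "\<lbrakk>A \<in> Obj W; B \<in> Obj W\<rbrakk> \<Longrightarrow> opm T A B \<cdot> mu T (A \<otimes>\<^sub>o B)
    = opm_tensor W T (mu T A) (mu T B) (ob T A) (ob T B) \<cdot> ar T (opm T A B)"
  using opmonoidal_transformation.opm_compatible[OF mu_opmonoidal, of A B]
    C.arrow_assoc[OF arrow_ar[OF arrow_opm] arrow_opm[OF ob_Obj ob_Obj] C.arrow_tensa[OF arrow_mu arrow_mu]]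
  by (simp add: comp_opfctr_def opm_tensor_def)

lemma opm_eta:
  assumes "A \<in> Obj W" "B \<in> Obj W"
  shows "opm T A B \<cdot> eta T (A \<otimes>\<^sub>o B) = eta T A \<otimes>\<^sub>a eta T B"
  using opmonoidal_transformation.opm_compatible[OF eta_opmonoidal assms]
    C.arrow_cmp_idn[OF C.arrow_tensa[OF arrow_eta arrow_eta], OF assms]
  by (simp add: id_opfctr_def)

text \<open>With \<open>opu_eta\<close>, these are the two algebra laws for the action
  \<open>opu T\<close> on the monoidal unit.\<close>

lemma opu_mu: "opu T \<cdot> mu T (unito W) = opu T \<cdot> ar T (opu T)"
  using opmonoidal_transformation.opu_compatible[OF mu_opmonoidal]
  by (simp add: comp_opfctr_def)

lemma opu_eta: "opu T \<cdot> eta T (unito W) = idn W (unito W)"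
  using opmonoidal_transformation.opu_compatible[OF eta_opmonoidal]
  by (simp add: id_opfctr_def)

lemma opm_tensor_mu:
  assumes Obj: "A \<in> Obj W" "B \<in> Obj W"
    and a: "arrow W a (ob T A) P" and b: "arrow W b (ob T B) Q"
  shows "opm_tensor W T a b A B \<cdot> mu T (A \<otimes>\<^sub>o B)
    = opm_tensor W T (a \<cdot> mu T A) (b \<cdot> mu T B) (ob T A) (ob T B) \<cdot> ar T (opm T A B)"
proof -
  note ObT = ob_Obj[OF Obj(1)] ob_Obj[OF Obj(2)]
  note ab = C.arrow_tensa[OF a b] and mA = arrow_mu[OF Obj(1)] and mB = arrow_mu[OF Obj(2)]
  have "opm_tensor W T a b A B \<cdot> mu T (A \<otimes>\<^sub>o B) = (a \<otimes>\<^sub>a b) \<cdot> opm T A B \<cdot> mu T (A \<otimes>\<^sub>o B)"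
    unfolding opm_tensor_def
    by (rule C.arrow_assoc[OF arrow_mu[OF C.tenso_Obj[OF Obj]] arrow_opm[OF Obj] ab])
  also have "\<dots> = ((a \<otimes>\<^sub>a b) \<cdot> opm_tensor W T (mu T A) (mu T B) (ob T A) (ob T B))
      \<cdot> ar T (opm T A B)"
    unfolding opm_mu[OF Obj]
    by (rule C.arrow_assoc[OF arrow_ar[OF arrow_opm[OF Obj]] arrow_opm_tensor[OF ObT mA mB] ab,
          symmetric])
  finally show ?thesis
    by (simp add: tensa_opm_tensor[OF ObT mA mB a b])
qed

text \<open>For actions \<open>a' = a\<close> and \<open>b' = b\<close> the right-hand side agrees
  with that of \<open>opm_tensor_mu\<close>, since
  \<open>a \<cdot> mu T A = a \<cdot> ar T a\<close> and likewise for \<open>b\<close>. This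
  comparison is the associativity of the tensored action.\<close>

lemma opm_tensor_ar_opm_tensor:
  assumes Obj: "A \<in> Obj W" "B \<in> Obj W"
    and a: "arrow W a (ob T A) P" and b: "arrow W b (ob T B) Q"
    and a': "arrow W a' (ob T P) P'" and b': "arrow W b' (ob T Q) Q'"
  shows "opm_tensor W T a' b' P Q \<cdot> ar T (opm_tensor W T a b A B)
    = opm_tensor W T (a' \<cdot> ar T a) (b' \<cdot> ar T b) (ob T A) (ob T B) \<cdot> ar T (opm T A B)"
proof -
  note ab = C.arrow_tensa[OF a b]
  have "opm_tensor W T a' b' P Q \<cdot> ar T (opm_tensor W T a b A B)
      = (opm_tensor W T a' b' P Q \<cdot> ar T (a \<otimes>\<^sub>a b)) \<cdot> ar T (opm T A B)"
    unfolding opm_tensor_def[of W T a b A B] arrow_ar_cmp[OF arrow_opm[OF Obj] ab]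
    by (rule C.arrow_assoc[OF arrow_ar[OF arrow_opm[OF Obj]] arrow_ar[OF ab]
          arrow_opm_tensor[OF arrowD(2)[OF a] arrowD(2)[OF b] a' b'], symmetric])
  thus ?thesis
    by (simp add: opm_tensor_ar_tensa[OF a b a' b'])
qed

lemma opm_tensor_eta:
  assumes Obj: "A \<in> Obj W" "B \<in> Obj W"
    and a: "arrow W a (ob T A) P" and b: "arrow W b (ob T B) Q"
  shows "opm_tensor W T a b A B \<cdot> eta T (A \<otimes>\<^sub>o B) = (a \<cdot> eta T A) \<otimes>\<^sub>a (b \<cdot> eta T B)"
  unfolding opm_tensor_def
  using C.arrow_assoc[OF arrow_eta[OF C.tenso_Obj[OF Obj]] arrow_opm[OF Obj] C.arrow_tensa[OF a b]]
    C.arrow_tensa_cmp[OF arrow_eta[OF Obj(1)] a arrow_eta[OF Obj(2)] b]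
  by (simp add: opm_eta[OF Obj])

end


section \<open>The Eilenberg--Moore category is monoidal\<close>

text \<open>The pair patterns of \<open>EM\<close> become projections, so these equations rewrite at
  an arbitrary algebra \<open>X\<close>. The tensored action appears as \<open>opm_tensor\<close>,
  to which the preceding identities apply.\<close>

lemma EM_simps [simp]:
  "Hom (EM W T) X Y = (Hom W (fst X) (fst Y))
    \<lparr>carrier := {f \<in> fst X \<leadsto>\<^bsub>W\<^esub> fst Y. f \<cdot>\<^bsub>W\<^esub> snd X = snd Y \<cdot>\<^bsub>W\<^esub> ar T f}\<rparr>"
  "cmp (EM W T) = cmp W"
  "idn (EM W T) X = idn W (fst X)"
  "tenso (EM W T) X Y = (fst X \<otimes>\<^sub>o\<^bsub>W\<^esub> fst Y, opm_tensor W T (snd X) (snd Y) (fst X) (fst Y))"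
  "tensa (EM W T) = tensa W"
  "unito (EM W T) = (unito W, opu T)"
  "associator (EM W T) X Y Z = associator W (fst X) (fst Y) (fst Z)"
  "lunitor (EM W T) X = lunitor W (fst X)"
  "runitor (EM W T) X = runitor W (fst X)"
  by (simp_all add: EM_def opm_tensor_def split: prod.splits)

context opmonoidal_monad
begin

lemma EM_Obj_iff:
  "X \<in> Obj (EM W T) \<longleftrightarrow> arrow W (snd X) (ob T (fst X)) (fst X)
    \<and> snd X \<cdot> mu T (fst X) = snd X \<cdot> ar T (snd X) \<and> snd X \<cdot> eta T (fst X) = idn W (fst X)"
  by (auto simp: EM_def arrow_def ob_Obj)

lemma EM_ObjD:
  assumes "X \<in> Obj (EM W T)"
  shows "fst X \<in> Obj W" "arrow W (snd X) (ob T (fst X)) (fst X)"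
    "snd X \<cdot> mu T (fst X) = snd X \<cdot> ar T (snd X)" "snd X \<cdot> eta T (fst X) = idn W (fst X)"
  using assms by (auto simp: EM_Obj_iff dest: arrowD)

lemma EM_arrow_iff:
  "\<lbrakk>X \<in> Obj (EM W T); Y \<in> Obj (EM W T)\<rbrakk> \<Longrightarrow> f \<in> X \<leadsto>\<^bsub>EM W T\<^esub> Y
    \<longleftrightarrow> arrow W f (fst X) (fst Y) \<and> f \<cdot> snd X = snd Y \<cdot> ar T f"
  by (auto simp: arrow_def dest: EM_ObjD)

lemma EM_arrowD:
  assumes "X \<in> Obj (EM W T)" "Y \<in> Obj (EM W T)" "f \<in> X \<leadsto>\<^bsub>EM W T\<^esub> Y"
  shows "arrow W f (fst X) (fst Y)" "f \<cdot> snd X = snd Y \<cdot> ar T f"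
  using assms by (simp_all add: EM_arrow_iff del: EM_simps)

lemma EM_free_Obj: "A \<in> Obj W \<Longrightarrow> (ob T A, mu T A) \<in> Obj (EM W T)"
  by (simp add: EM_Obj_iff arrow_mu mu_assoc mu_eta_left)

text \<open>Form for algebras that \<open>auto\<close> has split into explicit pairs.\<close>

lemma EM_Obj_pairD: "(A, a) \<in> Obj (EM W T) \<Longrightarrow> A \<in> Obj W"
  using EM_ObjD(1) by fastforce

text \<open>Algebra morphisms are the arrows on which the linear maps
  \<open>f \<mapsto> f \<cdot> a\<close> and \<open>f \<mapsto> b \<cdot> T f\<close> agree, hence
  they form a subspace.\<close>

lemma EM_hom_module:
  assumes X: "X \<in> Obj (EM W T)" and Y: "Y \<in> Obj (EM W T)"
  shows "module k (Hom (EM W T) X Y)"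
proof -
  note A = EM_ObjD(1)[OF X] and B = EM_ObjD(1)[OF Y]
  note TA = ob_Obj[OF A] and TB = ob_Obj[OF B]
  note a = arrowD(3)[OF EM_ObjD(2)[OF X]] and b = arrowD(3)[OF EM_ObjD(2)[OF Y]]
  interpret M: module k "Hom W (fst X) (fst Y)"
    by (rule C.hom_space[OF A B])
  let ?H = "{f \<in> fst X \<leadsto> fst Y. f \<cdot> snd X = snd Y \<cdot> ar T f}"
  have smult: "c \<odot>\<^bsub>Hom W (fst X) (fst Y)\<^esub> f \<in> ?H" if "c \<in> carrier k" "f \<in> ?H" for c f
    using that C.cmp_smult_left[OF TA A B a, of f c] ar_smult[OF A B, of f c]
      C.cmp_smult_right[OF TA TB B ar_arr[OF A B] b, of f c] by simp
  have add: "f \<oplus>\<^bsub>Hom W (fst X) (fst Y)\<^esub> g \<in> ?H" if "f \<in> ?H" "g \<in> ?H" for f g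
    using that C.cmp_add_left[OF TA A B a, of f g] ar_add[OF A B, of f g]
      C.cmp_add_right[OF TA TB B ar_arr[OF A B] ar_arr[OF A B] b, of f g] by simp
  let ?z = "\<zero>\<^bsub>Hom W (fst X) (fst Y)\<^esub>"
  interpret N: module k "Hom W (ob T (fst X)) (fst Y)"
    by (rule C.hom_space[OF TA B])
  \<comment> \<open>Preservation of zero follows from homogeneity: zero is written as the scalar
    \<open>0\<close> times itself, and the scalar is pulled out of each composite.\<close>
  have z: "?z = \<zero>\<^bsub>k\<^esub> \<odot>\<^bsub>Hom W (fst X) (fst Y)\<^esub> ?z"
    by simp
  have zero: "?z \<in> ?H"
  proof -
    have "?z \<cdot> snd X = \<zero>\<^bsub>Hom W (ob T (fst X)) (fst Y)\<^esub>"
      by (subst z, subst C.cmp_smult_left[OF TA A B a])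
        (auto intro!: N.smult_l_null C.cmp_arr[OF TA A B a])
    moreover have "snd Y \<cdot> ar T ?z = \<zero>\<^bsub>Hom W (ob T (fst X)) (fst Y)\<^esub>"
      by (subst z, subst ar_smult[OF A B], simp, simp,
          subst C.cmp_smult_right[OF TA TB B ar_arr[OF A B] b])
        (auto intro!: N.smult_l_null C.cmp_arr[OF TA TB B _ b] ar_arr[OF A B])
    ultimately show ?thesis
      by simp
  qed
  have "submodule ?H k (Hom W (fst X) (fst Y))"
  proof (rule M.submoduleI)
    \<comment> \<open>Negation is scalar multiplication by \<open>-1\<close>.\<close>
    fix f assume "f \<in> ?H"
    thus "\<ominus>\<^bsub>Hom W (fst X) (fst Y)\<^esub> f \<in> ?H"
      using smult[of "\<ominus>\<^bsub>k\<^esub> \<one>\<^bsub>k\<^esub>" f] M.smult_l_minus[of "\<one>\<^bsub>k\<^esub>" f] by auto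
  qed (use zero add smult in auto)
  from submodule.submodule_is_module[OF this M.module_axioms] show ?thesis
    by simp
qed

text \<open>Composition, identities and linear operations are those of \<open>W\<close>, so
  equations are inherited. The work is in closure: hom-spaces by \<open>EM_hom_module\<close>,
  composites by pasting the squares of two algebra morphisms.\<close>

lemma EM_linear_category: "linear_category k (EM W T)"
proof (rule linear_category.intro)
  show "field k" by (rule C.field)
next
  fix X Y Z f g assume O: "X \<in> Obj (EM W T)" "Y \<in> Obj (EM W T)" "Z \<in> Obj (EM W T)"
    and f: "f \<in> X \<leadsto>\<^bsub>EM W T\<^esub> Y" and g: "g \<in> Y \<leadsto>\<^bsub>EM W T\<^esub> Z"
  note x = EM_ObjD(2)[OF O(1)] and y = EM_ObjD(2)[OF O(2)] and z = EM_ObjD(2)[OF O(3)]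
  note f = EM_arrowD[OF O(1,2) f] and g = EM_arrowD[OF O(2,3) g]
  have "(g \<cdot> f) \<cdot> snd X = g \<cdot> snd Y \<cdot> ar T f"
    using C.arrow_assoc[OF x f(1) g(1)] f(2) by simp
  also have "\<dots> = snd Z \<cdot> ar T (g \<cdot> f)"
    using C.arrow_square[OF arrow_ar[OF f(1)] y g(1) arrow_ar[OF g(1)] z g(2)]
    by (simp add: arrow_ar_cmp[OF f(1) g(1)])
  finally show "g \<cdot>\<^bsub>EM W T\<^esub> f \<in> X \<leadsto>\<^bsub>EM W T\<^esub> Z"
    using EM_arrow_iff[OF O(1,3)] C.arrow_cmp[OF f(1) g(1)] by simp
qed (auto simp: EM_hom_module[simplified] C.idn_arr ar_idn
    C.arrow_idn_cmp[OF EM_ObjD(2)] C.arrow_cmp_idn[OF EM_ObjD(2)] EM_ObjD(1) dest!: EM_Obj_pairD,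
    (rule C.cmp_idn C.idn_cmp C.cmp_assoc C.cmp_add_left C.cmp_add_right C.cmp_smult_left
      C.cmp_smult_right; assumption)+)

lemma EM_tenso_Obj:
  assumes X: "X \<in> Obj (EM W T)" and Y: "Y \<in> Obj (EM W T)"
  shows "X \<otimes>\<^sub>o\<^bsub>EM W T\<^esub> Y \<in> Obj (EM W T)"
proof -
  note x = EM_ObjD[OF X] and y = EM_ObjD[OF Y]
  show ?thesis
    using arrow_opm_tensor[OF x(1) y(1) x(2) y(2)]
      opm_tensor_mu[OF x(1) y(1) x(2) y(2)]
      opm_tensor_ar_opm_tensor[OF x(1) y(1) x(2) y(2) x(2) y(2)]
      opm_tensor_eta[OF x(1) y(1) x(2) y(2)]
    by (simp add: EM_Obj_iff x(3,4) y(3,4) C.tensa_idn[OF x(1) y(1)])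
qed

lemma EM_unito_Obj: "unito (EM W T) \<in> Obj (EM W T)"
  by (simp add: EM_Obj_iff arrow_opu opu_mu opu_eta)

text \<open>Both sides of the morphism condition reduce to a single \<open>opm_tensor\<close>, and
  these coincide because \<open>f \<cdot> snd X = snd X' \<cdot> ar T f\<close>, and likewise for
  \<open>g\<close>.\<close>

lemma EM_tensa_arr:
  assumes O: "X \<in> Obj (EM W T)" "X' \<in> Obj (EM W T)" "Y \<in> Obj (EM W T)" "Y' \<in> Obj (EM W T)"
    and f: "f \<in> X \<leadsto>\<^bsub>EM W T\<^esub> X'" and g: "g \<in> Y \<leadsto>\<^bsub>EM W T\<^esub> Y'"
  shows "f \<otimes>\<^sub>a\<^bsub>EM W T\<^esub> g \<in> (X \<otimes>\<^sub>o\<^bsub>EM W T\<^esub> Y) \<leadsto>\<^bsub>EM W T\<^esub> (X' \<otimes>\<^sub>o\<^bsub>EM W T\<^esub> Y')"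
proof -
  note x = EM_ObjD[OF O(1)] and x' = EM_ObjD[OF O(2)] and y = EM_ObjD[OF O(3)] and y' = EM_ObjD[OF O(4)]
  note f = EM_arrowD[OF O(1,2) f] and g = EM_arrowD[OF O(3,4) g]
  show ?thesis
    using tensa_opm_tensor[OF x(1) y(1) x(2) y(2) f(1) g(1)]
      opm_tensor_ar_tensa[OF f(1) g(1) x'(2) y'(2)] arrowD(3)[OF C.arrow_tensa[OF f(1) g(1)]]
    by (simp add: f(2) g(2))
qed

text \<open>The forgetful functor reflects isomorphisms: \<open>inverse_square\<close> for
  \<open>f\<close> and \<open>ar T f\<close>, with the two actions as connecting arrows, shows that
  the inverse of \<open>f\<close> is again an algebra morphism.\<close>

lemma EM_iso_arrowI:
  assumes O: "X \<in> Obj (EM W T)" "Y \<in> Obj (EM W T)"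
    and f: "iso_arrow W (fst X) (fst Y) f" and eq: "f \<cdot> snd X = snd Y \<cdot> ar T f"
  shows "iso_arrow (EM W T) X Y f"
proof -
  note x = EM_ObjD[OF O(1)] and y = EM_ObjD[OF O(2)]
  obtain g where f: "arrow W f (fst X) (fst Y)" and g: "arrow W g (fst Y) (fst X)"
    and gf: "g \<cdot> f = idn W (fst X)" and fg: "f \<cdot> g = idn W (fst Y)"
    using iso_arrowE[OF f x(1) y(1)] .
  have "ar T f \<cdot> ar T g = idn W (ob T (fst Y))"
    using arrow_ar_cmp[OF g f] fg ar_idn[OF y(1)] by simp
  from C.inverse_square[OF f g gf arrow_ar[OF f] arrow_ar[OF g] this x(2) y(2) eq]
  show ?thesis
    using arrowD(3)[OF f] arrowD(3)[OF g] gf fg eq by (auto simp: iso_arrow_def)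
qed

text \<open>Equations between arrows are inherited from \<open>W\<close>. The new content is that
  tensor products and the unit are algebras and that the structural isomorphisms are algebra
  morphisms, which \<open>EM_iso_arrowI\<close> lifts.\<close>

lemma EM_monoidal_category: "monoidal_category k (EM W T)"
proof (intro monoidal_category.intro monoidal_category_axioms.intro)
  show "linear_category k (EM W T)" by (rule EM_linear_category)
  show "unito (EM W T) \<in> Obj (EM W T)" by (rule EM_unito_Obj)
next
  fix X Y assume "X \<in> Obj (EM W T)" "Y \<in> Obj (EM W T)"
  thus "X \<otimes>\<^sub>o\<^bsub>EM W T\<^esub> Y \<in> Obj (EM W T)" by (rule EM_tenso_Obj)
next
  fix X X' Y Y' f g
  assume "X \<in> Obj (EM W T)" "X' \<in> Obj (EM W T)" "Y \<in> Obj (EM W T)" "Y' \<in> Obj (EM W T)"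
    "f \<in> X \<leadsto>\<^bsub>EM W T\<^esub> X'" "g \<in> Y \<leadsto>\<^bsub>EM W T\<^esub> Y'"
  thus "f \<otimes>\<^sub>a\<^bsub>EM W T\<^esub> g \<in> (X \<otimes>\<^sub>o\<^bsub>EM W T\<^esub> Y) \<leadsto>\<^bsub>EM W T\<^esub> (X' \<otimes>\<^sub>o\<^bsub>EM W T\<^esub> Y')"
    by (rule EM_tensa_arr)
next
  fix X Y Z assume O: "X \<in> Obj (EM W T)" "Y \<in> Obj (EM W T)" "Z \<in> Obj (EM W T)"
  note x = EM_ObjD[OF O(1)] and y = EM_ObjD[OF O(2)] and z = EM_ObjD[OF O(3)]
  show "iso_arrow (EM W T) ((X \<otimes>\<^sub>o\<^bsub>EM W T\<^esub> Y) \<otimes>\<^sub>o\<^bsub>EM W T\<^esub> Z) (X \<otimes>\<^sub>o\<^bsub>EM W T\<^esub> (Y \<otimes>\<^sub>o\<^bsub>EM W T\<^esub> Z))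
      (associator (EM W T) X Y Z)"
    by (rule EM_iso_arrowI[OF EM_tenso_Obj[OF EM_tenso_Obj[OF O(1,2)] O(3)]
          EM_tenso_Obj[OF O(1) EM_tenso_Obj[OF O(2,3)]]])
      (simp_all add: C.associator_iso x(1) y(1) z(1)
        associator_opm_tensor[OF x(1) y(1) z(1) x(2) y(2) z(2)])
next
  fix X assume O: "X \<in> Obj (EM W T)"
  note x = EM_ObjD[OF O]
  show "iso_arrow (EM W T) (unito (EM W T) \<otimes>\<^sub>o\<^bsub>EM W T\<^esub> X) X (lunitor (EM W T) X)"
    by (rule EM_iso_arrowI[OF EM_tenso_Obj[OF EM_unito_Obj O] O])
      (simp_all add: C.lunitor_iso x(1) lunitor_opm_tensor[OF x(1,2)])
  show "iso_arrow (EM W T) (X \<otimes>\<^sub>o\<^bsub>EM W T\<^esub> unito (EM W T)) X (runitor (EM W T) X)"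
    by (rule EM_iso_arrowI[OF EM_tenso_Obj[OF O EM_unito_Obj] O])
      (simp_all add: C.runitor_iso x(1) runitor_opm_tensor[OF x(1,2)])
qed (auto dest!: EM_Obj_pairD simp: C.tensa_idn C.pentagon C.triangle C.lunitor_natural
      C.runitor_natural,
    (rule C.tensa_cmp C.tensa_add_left C.tensa_add_right C.tensa_smult_left C.tensa_smult_right
      C.associator_natural; assumption)+)

end


section \<open>The canonical module structure\<close>

lemma linear_functor_comp:
  assumes "linear_functor k C D F" "linear_functor k D E G"
  shows "linear_functor k C E (comp_fctr G F)"
proof -
  interpret F: linear_functor k C D F by fact
  interpret G: linear_functor k D E G by fact
  show ?thesis
    by unfold_locales
      (simp_all add: comp_fctr_def F.ob_Obj F.ar_arr F.ar_idn F.ar_add F.ar_smult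
        G.ob_Obj G.ar_arr G.ar_idn G.ar_add G.ar_smult
        F.arrow_ar_cmp[OF arrowI arrowI] G.arrow_ar_cmp[OF F.arrow_ar F.arrow_ar, OF arrowI arrowI])
qed

context left_module_category
begin

lemma arrow_acta:
  "\<lbrakk>arrow M f X X'; arrow C g V V'\<rbrakk>
    \<Longrightarrow> arrow C (f \<rhd>\<^sub>a\<^bsub>L\<^esub> g) (X \<rhd>\<^sub>o\<^bsub>L\<^esub> V) (X' \<rhd>\<^sub>o\<^bsub>L\<^esub> V')"
  by (simp add: arrow_def acta_arr acto_Obj)

lemma arrow_acta_cmp:
  "\<lbrakk>arrow M f X X'; arrow M f' X' X''; arrow C g V V'; arrow C g' V' V''\<rbrakk>
    \<Longrightarrow> (f' \<rhd>\<^sub>a\<^bsub>L\<^esub> g') \<cdot>\<^bsub>C\<^esub> (f \<rhd>\<^sub>a\<^bsub>L\<^esub> g) = (f' \<cdot>\<^bsub>M\<^esub> f) \<rhd>\<^sub>a\<^bsub>L\<^esub> (g' \<cdot>\<^bsub>C\<^esub> g)"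
  by (simp add: arrow_def acta_cmp[of X X' X'' V V' V''])

lemma arrow_act_coherence:
  "\<lbrakk>X \<in> Obj M; Y \<in> Obj M; V \<in> Obj C\<rbrakk> \<Longrightarrow> arrow C (act_assoc L X Y V)
    ((X \<otimes>\<^sub>o\<^bsub>M\<^esub> Y) \<rhd>\<^sub>o\<^bsub>L\<^esub> V) (X \<rhd>\<^sub>o\<^bsub>L\<^esub> (Y \<rhd>\<^sub>o\<^bsub>L\<^esub> V))"
  "V \<in> Obj C \<Longrightarrow> arrow C (act_unit L V) (unito M \<rhd>\<^sub>o\<^bsub>L\<^esub> V) V"
  using act_assoc_iso act_unit_iso
  by (auto simp: arrow_def iso_arrow_def acto_Obj M.tenso_Obj M.unito_Obj)

lemma oplax_module_functor_id:
  "oplax_module_functor k M C L id_fctr (\<lambda>X V. idn C (X \<rhd>\<^sub>o\<^bsub>L\<^esub> V))"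
proof unfold_locales
  fix X X' V V' f g
  assume "X \<in> Obj M" "X' \<in> Obj M" "V \<in> Obj C" "V' \<in> Obj C" "f \<in> X \<leadsto>\<^bsub>M\<^esub> X'" "g \<in> V \<leadsto>\<^bsub>C\<^esub> V'"
  from arrow_acta[OF arrowI[OF this(1,2,5)] arrowI[OF this(3,4,6)]]
  show "idn C (X' \<rhd>\<^sub>o\<^bsub>L\<^esub> V') \<cdot>\<^bsub>C\<^esub> ar id_fctr (f \<rhd>\<^sub>a\<^bsub>L\<^esub> g)
      = (f \<rhd>\<^sub>a\<^bsub>L\<^esub> ar id_fctr g) \<cdot>\<^bsub>C\<^esub> idn C (X \<rhd>\<^sub>o\<^bsub>L\<^esub> V)"
    by (simp add: id_fctr_def C.arrow_idn_cmp C.arrow_cmp_idn)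
next
  fix X Y V assume O: "X \<in> Obj M" "Y \<in> Obj M" "V \<in> Obj C"
  note [simp] = C.arrow_idn_cmp[OF arrow_act_coherence(1)[OF O]]
    C.arrow_cmp_idn[OF arrow_act_coherence(1)[OF O]]
  show "act_assoc L X Y (ob id_fctr V) \<cdot>\<^bsub>C\<^esub> idn C ((X \<otimes>\<^sub>o\<^bsub>M\<^esub> Y) \<rhd>\<^sub>o\<^bsub>L\<^esub> V)
      = (idn M X \<rhd>\<^sub>a\<^bsub>L\<^esub> idn C (Y \<rhd>\<^sub>o\<^bsub>L\<^esub> V)) \<cdot>\<^bsub>C\<^esub> idn C (X \<rhd>\<^sub>o\<^bsub>L\<^esub> (Y \<rhd>\<^sub>o\<^bsub>L\<^esub> V))
        \<cdot>\<^bsub>C\<^esub> ar id_fctr (act_assoc L X Y V)"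
    using O by (simp add: id_fctr_def acta_idn acto_Obj)
next
  fix V assume "V \<in> Obj C"
  from arrow_act_coherence(2)[OF this]
  show "act_unit L (ob id_fctr V) \<cdot>\<^bsub>C\<^esub> idn C (unito M \<rhd>\<^sub>o\<^bsub>L\<^esub> V) = ar id_fctr (act_unit L V)"
    by (simp add: id_fctr_def C.arrow_cmp_idn)
qed (simp_all add: id_fctr_def C.idn_arr acto_Obj)

end

lemma (in oplax_module_functor) arrow_s:
  "\<lbrakk>X \<in> Obj M; V \<in> Obj C\<rbrakk>
    \<Longrightarrow> arrow C (s X V) (ob F (X \<rhd>\<^sub>o\<^bsub>L\<^esub> V)) (X \<rhd>\<^sub>o\<^bsub>L\<^esub> ob F V)"
  by (simp add: arrow_def s_arr ob_Obj acto_Obj)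

text \<open>The multiplication of an oplax module monad has source \<open>T T\<close>, which must
  therefore be an oplax module functor. Each law is the image under \<open>G\<close> of the law of
  \<open>F\<close>, pasted with the law of \<open>G\<close>.\<close>

lemma oplax_module_functor_comp:
  assumes "oplax_module_functor k M C L F s" "oplax_module_functor k M C L G t"
  shows "oplax_module_functor k M C L (comp_fctr G F) (\<lambda>X V. t X (ob F V) \<cdot>\<^bsub>C\<^esub> ar G (s X V))"
proof -
  interpret F: oplax_module_functor k M C L F s by fact
  interpret G: oplax_module_functor k M C L G t by fact
  interpret GF: linear_functor k C C "comp_fctr G F"
    by (rule linear_functor_comp) unfold_locales
  note s = F.arrow_s and t = G.arrow_s and G = G.arrow_ar and Fo = F.ob_Obj and Go = G.ob_Obj
    and act = F.acto_Obj
  show ?thesis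
  proof unfold_locales
    fix X V assume O: "X \<in> Obj M" "V \<in> Obj C"
    show "t X (ob F V) \<cdot>\<^bsub>C\<^esub> ar G (s X V)
        \<in> ob (comp_fctr G F) (X \<rhd>\<^sub>o\<^bsub>L\<^esub> V) \<leadsto>\<^bsub>C\<^esub> (X \<rhd>\<^sub>o\<^bsub>L\<^esub> ob (comp_fctr G F) V)"
      using arrowD(3)[OF F.C.arrow_cmp[OF G[OF s[OF O]] t[OF O(1) Fo[OF O(2)]]]]
      by (simp add: comp_fctr_def)
  next
    fix X X' V V' f g
    assume O: "X \<in> Obj M" "X' \<in> Obj M" "V \<in> Obj C" "V' \<in> Obj C"
      and f: "f \<in> X \<leadsto>\<^bsub>M\<^esub> X'" and g: "g \<in> V \<leadsto>\<^bsub>C\<^esub> V'"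
    note af = arrowI[OF O(1,2) f] and ag = arrowI[OF O(3,4) g]
    note Fg = F.arrow_ar[OF ag] and FO = Fo[OF O(3)] Fo[OF O(4)]
    note fg = F.arrow_acta[OF af ag] and fFg = F.arrow_acta[OF af Fg]
      and fGFg = F.arrow_acta[OF af G[OF Fg]]
    note s1 = s[OF O(1,3)] and s2 = s[OF O(2,4)] and t1 = t[OF O(1) FO(1)] and t2 = t[OF O(2) FO(2)]
    have "(t X' (ob F V') \<cdot>\<^bsub>C\<^esub> ar G (s X' V')) \<cdot>\<^bsub>C\<^esub> ar G (ar F (f \<rhd>\<^sub>a\<^bsub>L\<^esub> g))
        = t X' (ob F V') \<cdot>\<^bsub>C\<^esub> ar G (s X' V') \<cdot>\<^bsub>C\<^esub> ar G (ar F (f \<rhd>\<^sub>a\<^bsub>L\<^esub> g))"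
      by (rule F.C.arrow_assoc[OF G[OF F.arrow_ar[OF fg]] G[OF s2] t2])
    also have "\<dots> = t X' (ob F V') \<cdot>\<^bsub>C\<^esub> ar G (f \<rhd>\<^sub>a\<^bsub>L\<^esub> ar F g) \<cdot>\<^bsub>C\<^esub> ar G (s X V)"
      using F.s_natural[OF O f g] G.arrow_ar_cmp[OF F.arrow_ar[OF fg] s2] G.arrow_ar_cmp[OF s1 fFg]
      by simp
    also have "\<dots> = (f \<rhd>\<^sub>a\<^bsub>L\<^esub> ar G (ar F g)) \<cdot>\<^bsub>C\<^esub> t X (ob F V) \<cdot>\<^bsub>C\<^esub> ar G (s X V)"
      by (rule F.C.arrow_square[OF G[OF s1] G[OF fFg] t2 t1 fGFg
            G.s_natural[OF O(1,2) FO f arrowD(3)[OF Fg]]])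
    finally show "(t X' (ob F V') \<cdot>\<^bsub>C\<^esub> ar G (s X' V')) \<cdot>\<^bsub>C\<^esub> ar (comp_fctr G F) (f \<rhd>\<^sub>a\<^bsub>L\<^esub> g)
        = (f \<rhd>\<^sub>a\<^bsub>L\<^esub> ar (comp_fctr G F) g) \<cdot>\<^bsub>C\<^esub> t X (ob F V) \<cdot>\<^bsub>C\<^esub> ar G (s X V)"
      by (simp add: comp_fctr_def)
  next
    fix X Y V assume O: "X \<in> Obj M" "Y \<in> Obj M" "V \<in> Obj C"
    note XY = F.M.tenso_Obj[OF O(1,2)] and FV = Fo[OF O(3)] and YV = act[OF O(2,3)]
    note YFV = act[OF O(2) FV]
    note idX = F.M.arrow_idn[OF O(1)]
    note \<alpha> = F.arrow_act_coherence(1)[OF O] and \<alpha>F = F.arrow_act_coherence(1)[OF O(1,2) FV]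
      and \<alpha>GF = F.arrow_act_coherence(1)[OF O(1,2) Go[OF FV]]
    note sXY = s[OF XY O(3)] and sY = s[OF O(2,3)] and sX = s[OF O(1) YV]
    note tXY = t[OF XY FV] and tY = t[OF O(2) FV] and tX = t[OF O(1) YFV]
      and tX' = t[OF O(1) Fo[OF YV]]
    note XsY = F.arrow_acta[OF idX sY] and XGsY = F.arrow_acta[OF idX G[OF sY]]
      and XtY = F.arrow_acta[OF idX tY]
    note GF\<alpha> = G[OF F.arrow_ar[OF \<alpha>]]
    note r = F.C.arrow_cmp[OF GF\<alpha> G[OF sX]]
    have G\<alpha>: "ar G (act_assoc L X Y (ob F V)) \<cdot>\<^bsub>C\<^esub> ar G (s (X \<otimes>\<^sub>o\<^bsub>M\<^esub> Y) V)
        = ar G (idn M X \<rhd>\<^sub>a\<^bsub>L\<^esub> s Y V) \<cdot>\<^bsub>C\<^esub> ar G (s X (Y \<rhd>\<^sub>o\<^bsub>L\<^esub> V))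
          \<cdot>\<^bsub>C\<^esub> ar G (ar F (act_assoc L X Y V))"
      using F.s_assoc[OF O] G.arrow_ar_cmp[OF sXY \<alpha>F] G.arrow_ar_cmp[OF F.arrow_ar[OF \<alpha>] sX]
        G.arrow_ar_cmp[OF F.C.arrow_cmp[OF F.arrow_ar[OF \<alpha>] sX] XsY] by simp
    \<comment> \<open>First the law of \<open>G\<close> at \<open>ob F V\<close>, then the image
      under \<open>G\<close> of the law of \<open>F\<close>. Naturality of \<open>t\<close> along
      \<open>s Y V\<close> finally brings the factors into the order of the composite
      structure.\<close>
    have "act_assoc L X Y (ob G (ob F V))
          \<cdot>\<^bsub>C\<^esub> t (X \<otimes>\<^sub>o\<^bsub>M\<^esub> Y) (ob F V) \<cdot>\<^bsub>C\<^esub> ar G (s (X \<otimes>\<^sub>o\<^bsub>M\<^esub> Y) V)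
        = (idn M X \<rhd>\<^sub>a\<^bsub>L\<^esub> t Y (ob F V))
          \<cdot>\<^bsub>C\<^esub> (t X (Y \<rhd>\<^sub>o\<^bsub>L\<^esub> ob F V) \<cdot>\<^bsub>C\<^esub> ar G (act_assoc L X Y (ob F V)))
          \<cdot>\<^bsub>C\<^esub> ar G (s (X \<otimes>\<^sub>o\<^bsub>M\<^esub> Y) V)"
      by (rule F.C.arrow_square[OF G[OF sXY] tXY \<alpha>GF F.C.arrow_cmp[OF G[OF \<alpha>F] tX] XtY
            G.s_assoc[OF O(1,2) FV]])
    also have "\<dots> = (idn M X \<rhd>\<^sub>a\<^bsub>L\<^esub> t Y (ob F V)) \<cdot>\<^bsub>C\<^esub> t X (Y \<rhd>\<^sub>o\<^bsub>L\<^esub> ob F V)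
          \<cdot>\<^bsub>C\<^esub> ar G (idn M X \<rhd>\<^sub>a\<^bsub>L\<^esub> s Y V) \<cdot>\<^bsub>C\<^esub> ar G (s X (Y \<rhd>\<^sub>o\<^bsub>L\<^esub> V))
          \<cdot>\<^bsub>C\<^esub> ar G (ar F (act_assoc L X Y V))"
      by (simp add: F.C.arrow_assoc[OF G[OF sXY] G[OF \<alpha>F] tX] G\<alpha>)
    also have "\<dots> = (idn M X \<rhd>\<^sub>a\<^bsub>L\<^esub> t Y (ob F V)) \<cdot>\<^bsub>C\<^esub> (idn M X \<rhd>\<^sub>a\<^bsub>L\<^esub> ar G (s Y V))
          \<cdot>\<^bsub>C\<^esub> t X (ob F (Y \<rhd>\<^sub>o\<^bsub>L\<^esub> V)) \<cdot>\<^bsub>C\<^esub> ar G (s X (Y \<rhd>\<^sub>o\<^bsub>L\<^esub> V))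
          \<cdot>\<^bsub>C\<^esub> ar G (ar F (act_assoc L X Y V))"
      by (simp add: F.C.arrow_square[OF r G[OF XsY] tX tX' XGsY
            G.s_natural[OF O(1,1) Fo[OF YV] YFV F.M.idn_arr[OF O(1)] arrowD(3)[OF sY]]])
    also have "\<dots> = ((idn M X \<rhd>\<^sub>a\<^bsub>L\<^esub> t Y (ob F V)) \<cdot>\<^bsub>C\<^esub> (idn M X \<rhd>\<^sub>a\<^bsub>L\<^esub> ar G (s Y V)))
          \<cdot>\<^bsub>C\<^esub> (t X (ob F (Y \<rhd>\<^sub>o\<^bsub>L\<^esub> V)) \<cdot>\<^bsub>C\<^esub> ar G (s X (Y \<rhd>\<^sub>o\<^bsub>L\<^esub> V)))
          \<cdot>\<^bsub>C\<^esub> ar G (ar F (act_assoc L X Y V))"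
      by (simp add: F.C.arrow_assoc[OF F.C.arrow_cmp[OF r tX'] XGsY XtY]
          F.C.arrow_assoc[OF GF\<alpha> G[OF sX] tX'])
    finally show "act_assoc L X Y (ob (comp_fctr G F) V)
          \<cdot>\<^bsub>C\<^esub> t (X \<otimes>\<^sub>o\<^bsub>M\<^esub> Y) (ob F V) \<cdot>\<^bsub>C\<^esub> ar G (s (X \<otimes>\<^sub>o\<^bsub>M\<^esub> Y) V)
        = (idn M X \<rhd>\<^sub>a\<^bsub>L\<^esub> (t Y (ob F V) \<cdot>\<^bsub>C\<^esub> ar G (s Y V)))
          \<cdot>\<^bsub>C\<^esub> (t X (ob F (Y \<rhd>\<^sub>o\<^bsub>L\<^esub> V)) \<cdot>\<^bsub>C\<^esub> ar G (s X (Y \<rhd>\<^sub>o\<^bsub>L\<^esub> V)))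
          \<cdot>\<^bsub>C\<^esub> ar (comp_fctr G F) (act_assoc L X Y V)"
      by (simp add: comp_fctr_def F.arrow_acta_cmp[OF idX idX G[OF sY] tY] F.M.arrow_idn_cmp[OF idX])
  next
    fix V assume V: "V \<in> Obj C"
    note FV = Fo[OF V] and U = F.M.unito_Obj
    note uF = F.arrow_act_coherence(2)[OF FV] and uGF = F.arrow_act_coherence(2)[OF Go[OF FV]]
    have "act_unit L (ob G (ob F V)) \<cdot>\<^bsub>C\<^esub> t (unito M) (ob F V) \<cdot>\<^bsub>C\<^esub> ar G (s (unito M) V)
        = ar G (act_unit L (ob F V)) \<cdot>\<^bsub>C\<^esub> ar G (s (unito M) V)"
      using F.C.arrow_assoc[OF G[OF s[OF U V]] t[OF U FV] uGF] G.s_unit[OF FV] by simp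
    also have "\<dots> = ar G (ar F (act_unit L V))"
      using G.arrow_ar_cmp[OF s[OF U V] uF] F.s_unit[OF V] by simp
    finally show "act_unit L (ob (comp_fctr G F) V)
          \<cdot>\<^bsub>C\<^esub> t (unito M) (ob F V) \<cdot>\<^bsub>C\<^esub> ar G (s (unito M) V)
        = ar (comp_fctr G F) (act_unit L V)"
      by (simp add: comp_fctr_def)
  qed
qed

section \<open>The action of the Eilenberg--Moore category on the base and the coherence morphisms
  of the monad\<close>

lemma EM_action_simps [simp]:
  "acto (EM_action W) X V = fst X \<otimes>\<^sub>o\<^bsub>W\<^esub> V"
  "acta (EM_action W) = tensa W"
  "act_assoc (EM_action W) X Y V = associator W (fst X) (fst Y) V"
  "act_unit (EM_action W) = lunitor W"
  by (simp_all add: EM_action_def EM_forget_def fun_eq_iff)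

text \<open>The counit component at an algebra is its action, so the coherence morphisms fall under
  the calculus of \<open>opm_tensor\<close>.\<close>

lemma canonical_oplax_eq:
  "canonical_oplax W T X V = opm_tensor W T (snd X) (idn W (ob T V)) (fst X) V"
  by (simp add: canonical_oplax_def EM_forget_def EM_counit_def opm_tensor_def)

context opmonoidal_monad
begin

text \<open>This is the regular action of \<open>W\<close> on itself, restricted along the strict
  monoidal forgetful functor; module coherence is therefore the pentagon and triangle of
  \<open>W\<close>.\<close>

lemma EM_left_module_category: "left_module_category k (EM W T) W (EM_action W)"
proof (intro left_module_category.intro left_module_category_axioms.intro)
  show "monoidal_category k (EM W T)" by (rule EM_monoidal_category)
  show "linear_category k W" by unfold_locales
qed (auto dest!: EM_Obj_pairD simp: C.tenso_Obj C.tensa_arr C.tensa_idn C.associator_iso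
      C.lunitor_iso C.pentagon C.triangle C.lunitor_natural,
    (rule C.tensa_cmp C.tensa_add_left C.tensa_add_right C.tensa_smult_left C.tensa_smult_right
      C.associator_natural; assumption)+)

lemma arrow_idn_ob: "V \<in> Obj W \<Longrightarrow> arrow W (idn W (ob T V)) (ob T V) (ob T V)"
  by (rule C.arrow_idn[OF ob_Obj])

lemma arrow_canonical_oplax:
  assumes X: "X \<in> Obj (EM W T)" and V: "V \<in> Obj W"
  shows "arrow W (canonical_oplax W T X V) (ob T (fst X \<otimes>\<^sub>o V)) (fst X \<otimes>\<^sub>o ob T V)"
  unfolding canonical_oplax_eq
  by (rule arrow_opm_tensor[OF EM_ObjD(1)[OF X] V EM_ObjD(2)[OF X] arrow_idn_ob[OF V]])

text \<open>In the first variable the square rests on the morphism condition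
  \<open>f \<cdot> snd X = snd Y \<cdot> ar T f\<close>; in the second, on naturality of
  \<open>opm\<close> alone.\<close>

lemma canonical_oplax_natural:
  assumes X: "X \<in> Obj (EM W T)" and Y: "Y \<in> Obj (EM W T)"
    and f: "f \<in> X \<leadsto>\<^bsub>EM W T\<^esub> Y" and g: "arrow W g V V'"
  shows "canonical_oplax W T Y V' \<cdot> ar T (f \<otimes>\<^sub>a g) = (f \<otimes>\<^sub>a ar T g) \<cdot> canonical_oplax W T X V"
proof -
  note x = EM_ObjD[OF X] and y = EM_ObjD[OF Y] and f = EM_arrowD[OF X Y f]
  note V = arrowD(1,2)[OF g] and Tg = arrow_ar[OF g]
  show ?thesis
    unfolding canonical_oplax_eq
    using opm_tensor_ar_tensa[OF f(1) g y(2) arrow_idn_ob[OF V(2)]]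
      tensa_opm_tensor[OF x(1) V(1) x(2) arrow_idn_ob[OF V(1)] f(1) Tg]
    by (simp add: f(2) C.arrow_idn_cmp[OF Tg] C.arrow_cmp_idn[OF Tg])
qed

lemma canonical_oplax_module_functor:
  "oplax_module_functor k (EM W T) W (EM_action W) T (canonical_oplax W T)"
proof (intro oplax_module_functor.intro oplax_module_functor_axioms.intro)
  show "linear_functor k W W T" by unfold_locales
  show "left_module_category k (EM W T) W (EM_action W)" by (rule EM_left_module_category)
next
  fix X V assume "X \<in> Obj (EM W T)" "V \<in> Obj W"
  thus "canonical_oplax W T X V \<in> ob T (X \<rhd>\<^sub>o\<^bsub>EM_action W\<^esub> V) \<leadsto> (X \<rhd>\<^sub>o\<^bsub>EM_action W\<^esub> ob T V)"
    using arrowD(3)[OF arrow_canonical_oplax] by simp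
next
  fix X X' V V' f g
  assume "X \<in> Obj (EM W T)" "X' \<in> Obj (EM W T)" "V \<in> Obj W" "V' \<in> Obj W"
    "f \<in> X \<leadsto>\<^bsub>EM W T\<^esub> X'" "g \<in> V \<leadsto> V'"
  from canonical_oplax_natural[OF this(1,2,5) arrowI[OF this(3,4,6)]]
  show "canonical_oplax W T X' V' \<cdot> ar T (f \<rhd>\<^sub>a\<^bsub>EM_action W\<^esub> g)
      = (f \<rhd>\<^sub>a\<^bsub>EM_action W\<^esub> ar T g) \<cdot> canonical_oplax W T X V"
    by simp
next
  fix X Y V assume O: "X \<in> Obj (EM W T)" "Y \<in> Obj (EM W T)" and V: "V \<in> Obj W"
  note x = EM_ObjD[OF O(1)] and y = EM_ObjD[OF O(2)] and iV = arrow_idn_ob[OF V]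
  note YV = C.tenso_Obj[OF y(1) V]
  note sX = arrow_canonical_oplax[OF O(1) YV] and sY = arrow_canonical_oplax[OF O(2) V]
  note iX = C.arrow_idn[OF x(1)]
  have "associator W (fst X) (fst Y) (ob T V) \<cdot> canonical_oplax W T (X \<otimes>\<^sub>o\<^bsub>EM W T\<^esub> Y) V
      = opm_tensor W T (snd X) (canonical_oplax W T Y V) (fst X) (fst Y \<otimes>\<^sub>o V)
        \<cdot> ar T (associator W (fst X) (fst Y) V)"
    using associator_opm_tensor[OF x(1) y(1) V x(2) y(2) iV] by (simp add: canonical_oplax_eq)
  \<comment> \<open>The coherence morphism at \<open>Y\<close> sits in the second leg. Interchange
    extracts it as an outer factor and leaves the coherence morphism at \<open>X\<close>.\<close>
  also have "opm_tensor W T (snd X) (canonical_oplax W T Y V) (fst X) (fst Y \<otimes>\<^sub>o V)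
      = (idn W (fst X) \<otimes>\<^sub>a canonical_oplax W T Y V) \<cdot> canonical_oplax W T X (fst Y \<otimes>\<^sub>o V)"
    unfolding canonical_oplax_eq[of W T X]
    using tensa_opm_tensor[OF x(1) YV x(2) arrow_idn_ob[OF YV] iX sY]
    by (simp add: C.arrow_idn_cmp[OF x(2)] C.arrow_cmp_idn[OF sY])
  also have "\<dots> \<cdot> ar T (associator W (fst X) (fst Y) V)
      = (idn W (fst X) \<otimes>\<^sub>a canonical_oplax W T Y V) \<cdot> canonical_oplax W T X (fst Y \<otimes>\<^sub>o V)
        \<cdot> ar T (associator W (fst X) (fst Y) V)"
    by (rule C.arrow_assoc[OF arrow_ar[OF C.arrow_coherence(1)[OF x(1) y(1) V]] sX
          C.arrow_tensa[OF iX sY]])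
  finally show "act_assoc (EM_action W) X Y (ob T V) \<cdot> canonical_oplax W T (X \<otimes>\<^sub>o\<^bsub>EM W T\<^esub> Y) V
      = (idn (EM W T) X \<rhd>\<^sub>a\<^bsub>EM_action W\<^esub> canonical_oplax W T Y V)
        \<cdot> canonical_oplax W T X (Y \<rhd>\<^sub>o\<^bsub>EM_action W\<^esub> V) \<cdot> ar T (act_assoc (EM_action W) X Y V)"
    by simp
next
  fix V assume V: "V \<in> Obj W"
  \<comment> \<open>The unit algebra has action \<open>opu T\<close>, so this is left counitality of
    \<open>T\<close>.\<close>
  show "act_unit (EM_action W) (ob T V) \<cdot> canonical_oplax W T (unito (EM W T)) V
      = ar T (act_unit (EM_action W) V)"
    using lunitor_opm_tensor[OF V arrow_idn_ob[OF V]]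
      C.arrow_idn_cmp[OF arrow_ar[OF C.arrow_coherence(2)[OF V]]]
    by (simp add: canonical_oplax_eq)
qed

text \<open>\<open>opm_tensor_mu\<close> puts a multiplication in each leg. The first is turned into
  \<open>snd X \<cdot> ar T (snd X)\<close> by the action law; the second is extracted by
  interchange.\<close>

lemma canonical_oplax_mu:
  assumes X: "X \<in> Obj (EM W T)" and V: "V \<in> Obj W"
  shows "canonical_oplax W T X V \<cdot> mu T (fst X \<otimes>\<^sub>o V)
    = (idn W (fst X) \<otimes>\<^sub>a mu T V) \<cdot> canonical_oplax W T X (ob T V) \<cdot> ar T (canonical_oplax W T X V)"
proof -
  note x = EM_ObjD[OF X] and TV = ob_Obj[OF V] and iV = arrow_idn_ob[OF V]
  note iTV = arrow_idn_ob[OF TV] and m = arrow_mu[OF V] and TX = ob_Obj[OF x(1)]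
  note ax = C.arrow_cmp[OF arrow_ar[OF x(2)] x(2)]
  \<comment> \<open>With the identity as second leg, \<open>?R\<close> followed by nothing but its
    inner comparison morphism under \<open>T\<close> is the coherence morphism of the composite
    \<open>T T\<close>.\<close>
  let ?R = "opm_tensor W T (snd X \<cdot> ar T (snd X)) (idn W (ob T (ob T V)))
      (ob T (fst X)) (ob T V)"
  have "canonical_oplax W T X V \<cdot> mu T (fst X \<otimes>\<^sub>o V)
      = opm_tensor W T (snd X \<cdot> ar T (snd X)) (mu T V) (ob T (fst X)) (ob T V)
        \<cdot> ar T (opm T (fst X) V)"
    unfolding canonical_oplax_eq
    by (simp add: opm_tensor_mu[OF x(1) V x(2) iV] x(3) C.arrow_idn_cmp[OF m])
  also have "\<dots> = ((idn W (fst X) \<otimes>\<^sub>a mu T V) \<cdot> ?R) \<cdot> ar T (opm T (fst X) V)"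
    by (simp add: tensa_opm_tensor[OF TX TV ax iTV C.arrow_idn[OF x(1)] m]
        C.arrow_idn_cmp[OF ax] C.arrow_cmp_idn[OF m])
  also have "\<dots> = (idn W (fst X) \<otimes>\<^sub>a mu T V) \<cdot> ?R \<cdot> ar T (opm T (fst X) V)"
    by (rule C.arrow_assoc[OF arrow_ar[OF arrow_opm[OF x(1) V]] arrow_opm_tensor[OF TX TV ax iTV]
          C.arrow_tensa[OF C.arrow_idn[OF x(1)] m]])
  also have "?R \<cdot> ar T (opm T (fst X) V)
      = canonical_oplax W T X (ob T V) \<cdot> ar T (canonical_oplax W T X V)"
    unfolding canonical_oplax_eq
    by (simp add: opm_tensor_ar_opm_tensor[OF x(1) V x(2) iV x(2) iTV] ar_idn[OF TV]
        C.arrow_idn_cmp[OF iTV])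
  finally show ?thesis .
qed

lemma canonical_oplax_eta:
  assumes X: "X \<in> Obj (EM W T)" and V: "V \<in> Obj W"
  shows "canonical_oplax W T X V \<cdot> eta T (fst X \<otimes>\<^sub>o V) = idn W (fst X) \<otimes>\<^sub>a eta T V"
  unfolding canonical_oplax_eq
  using opm_tensor_eta[OF EM_ObjD(1)[OF X] V EM_ObjD(2)[OF X] arrow_idn_ob[OF V]]
    EM_ObjD(4)[OF X] C.arrow_idn_cmp[OF arrow_eta[OF V]]
  by simp

lemma canonical_oplax_module_monad:
  "oplax_module_monad k (EM W T) W (EM_action W) T (mu T) (eta T) (canonical_oplax W T)"
proof (intro oplax_module_monad.intro oplax_module_monad_axioms.intro
    oplax_module_transformation.intro oplax_module_transformation_axioms.intro)
  note L = EM_left_module_category and S = canonical_oplax_module_functor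
  show "linear_monad k W T (mu T) (eta T)" by unfold_locales
  \<comment> \<open>Three copies of one goal: for \<open>T\<close> itself, and for \<open>T\<close>
    as the target of the multiplication and of the unit.\<close>
  show "oplax_module_functor k (EM W T) W (EM_action W) T (canonical_oplax W T)"
    "oplax_module_functor k (EM W T) W (EM_action W) T (canonical_oplax W T)"
    "oplax_module_functor k (EM W T) W (EM_action W) T (canonical_oplax W T)"
    by (rule S)+
  show "oplax_module_functor k (EM W T) W (EM_action W) (comp_fctr T T)
      (\<lambda>X V. canonical_oplax W T X (ob T V) \<cdot> ar T (canonical_oplax W T X V))"
    by (rule oplax_module_functor_comp[OF S S])
  show "oplax_module_functor k (EM W T) W (EM_action W) id_fctr
      (\<lambda>X V. idn W (X \<rhd>\<^sub>o\<^bsub>EM_action W\<^esub> V))"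
    by (rule left_module_category.oplax_module_functor_id[OF L])
  show "natural_transformation k W W (comp_fctr T T) T (mu T)" by (rule mu_natural)
  show "natural_transformation k W W id_fctr T (eta T)" by (rule eta_natural)
next
  fix X V assume O: "X \<in> Obj (EM W T)" "V \<in> Obj W"
  note x = EM_ObjD[OF O(1)]
  show "canonical_oplax W T X V \<cdot> mu T (X \<rhd>\<^sub>o\<^bsub>EM_action W\<^esub> V)
      = (idn (EM W T) X \<rhd>\<^sub>a\<^bsub>EM_action W\<^esub> mu T V)
        \<cdot> canonical_oplax W T X (ob T V) \<cdot> ar T (canonical_oplax W T X V)"
    by (simp add: canonical_oplax_mu[OF O])
  show "canonical_oplax W T X V \<cdot> eta T (X \<rhd>\<^sub>o\<^bsub>EM_action W\<^esub> V)
      = (idn (EM W T) X \<rhd>\<^sub>a\<^bsub>EM_action W\<^esub> eta T V) \<cdot> idn W (X \<rhd>\<^sub>o\<^bsub>EM_action W\<^esub> V)"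
    using C.arrow_cmp_idn[OF C.arrow_tensa[OF C.arrow_idn[OF x(1)] arrow_eta[OF O(2)]]]
    by (simp add: canonical_oplax_eta[OF O])
qed


section \<open>Invertibility of the fusion operators\<close>

lemma right_fusion_eq: "right_fusion W T A V = canonical_oplax W T (ob T A, mu T A) V"
  by (simp add: right_fusion_def canonical_oplax_eq opm_tensor_def)

text \<open>The split coequalizer lemma is applied to \<open>TTA => TA -> A\<close>, under
  \<open>T (- \<otimes> V)\<close> in the upper row and \<open>- \<otimes> TV\<close> in the lower.
  The comparisons are the coherence morphisms at the free algebras on \<open>TA\<close> and
  \<open>A\<close>, which are fusion operators, and at \<open>X\<close>.\<close>

lemma iso_canonical_oplax:
  assumes fusion: "right_fusion_invertible W T" and X: "X \<in> Obj (EM W T)" and V: "V \<in> Obj W"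
  shows "iso_arrow W (ob T (fst X \<otimes>\<^sub>o V)) (fst X \<otimes>\<^sub>o ob T V) (canonical_oplax W T X V)"
proof -
  define A where "A = fst X"
  define a where "a = snd X"
  note x = EM_ObjD[OF X, folded A_def a_def]
  note A = x(1) and TA = ob_Obj[OF x(1)] and iV = C.arrow_idn[OF V] and iTV = arrow_idn_ob[OF V]
  note TV = ob_Obj[OF V]
  note FA = EM_free_Obj[OF A] and FTA = EM_free_Obj[OF TA]
  note Ta = arrow_ar[OF x(2)] and m = arrow_mu[OF A]
  note e = arrow_eta[OF A] and e' = arrow_eta[OF TA]
  have fA: "(f \<otimes>\<^sub>a idn W B) \<cdot> (g \<otimes>\<^sub>a idn W B) = (f \<cdot> g) \<otimes>\<^sub>a idn W B"
    if "arrow W g P Q" "arrow W f Q R" "B \<in> Obj W" for f g P Q R B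
    using C.arrow_tensa_cmp[OF that(1,2) C.arrow_idn[OF that(3)] C.arrow_idn[OF that(3)]]
      C.arrow_idn_cmp[OF C.arrow_idn[OF that(3)]] by simp
  have whisker: "arrow W (f \<otimes>\<^sub>a idn W B) (P \<otimes>\<^sub>o B) (Q \<otimes>\<^sub>o B)"
    if "arrow W f P Q" "B \<in> Obj W" for f P Q B
    by (rule C.arrow_tensa[OF that(1) C.arrow_idn[OF that(2)]])
  have ar_whisker: "ar T (f \<otimes>\<^sub>a idn W V) \<cdot> ar T (g \<otimes>\<^sub>a idn W V) = ar T ((f \<cdot> g) \<otimes>\<^sub>a idn W V)"
    if "arrow W g P Q" "arrow W f Q R" for f g P Q R
    using arrow_ar_cmp[OF whisker[OF that(1) V] whisker[OF that(2) V]] fA[OF that V] by simp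
  \<comment> \<open>All three squares of the comparison are instances of this, so \<open>a\<close>,
    \<open>mu T A\<close> and \<open>ar T a\<close> have to be algebra morphisms.\<close>
  have nat: "canonical_oplax W T Z V \<cdot> ar T (f \<otimes>\<^sub>a idn W V)
      = (f \<otimes>\<^sub>a idn W (ob T V)) \<cdot> canonical_oplax W T Y V"
    if "Y \<in> Obj (EM W T)" "Z \<in> Obj (EM W T)" "arrow W f (fst Y) (fst Z)"
      "f \<cdot> snd Y = snd Z \<cdot> ar T f" for Y Z f
    using canonical_oplax_natural[OF that(1,2) _ iV] that EM_arrow_iff[OF that(1,2)]
    by (simp add: ar_idn[OF V])
  have iso: "iso_arrow W (ob T (ob T B \<otimes>\<^sub>o V)) (ob T B \<otimes>\<^sub>o ob T V)
      (canonical_oplax W T (ob T B, mu T B) V)" if "B \<in> Obj W" for B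
    using fusion that V by (simp add: right_fusion_invertible_def right_fusion_eq)
  show ?thesis
  proof (fold A_def, rule C.iso_arrow_split_coequalizer[where
        p = "ar T (a \<otimes>\<^sub>a idn W V)" and e = "ar T (eta T A \<otimes>\<^sub>a idn W V)"
        and d = "ar T (mu T A \<otimes>\<^sub>a idn W V)" and h = "ar T (ar T a \<otimes>\<^sub>a idn W V)"
        and p' = "a \<otimes>\<^sub>a idn W (ob T V)" and s = "eta T A \<otimes>\<^sub>a idn W (ob T V)"
        and d' = "mu T A \<otimes>\<^sub>a idn W (ob T V)" and h' = "ar T a \<otimes>\<^sub>a idn W (ob T V)"
        and t = "eta T (ob T A) \<otimes>\<^sub>a idn W (ob T V)"])
    show "iso_arrow W (ob T (ob T A \<otimes>\<^sub>o V)) (ob T A \<otimes>\<^sub>o ob T V)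
        (canonical_oplax W T (ob T A, mu T A) V)"
      by (rule iso[OF A])
    show "iso_arrow W (ob T (ob T (ob T A) \<otimes>\<^sub>o V)) (ob T (ob T A) \<otimes>\<^sub>o ob T V)
        (canonical_oplax W T (ob T (ob T A), mu T (ob T A)) V)"
      by (rule iso[OF TA])
    show "arrow W (canonical_oplax W T X V) (ob T (A \<otimes>\<^sub>o V)) (A \<otimes>\<^sub>o ob T V)"
      using arrow_canonical_oplax[OF X V] by (simp add: A_def)
    \<comment> \<open>In this and the next two squares, the morphism condition is the action law for
      \<open>a\<close>, associativity of the monad for \<open>mu T A\<close>, and naturality of
      \<open>mu\<close> for \<open>ar T a\<close>.\<close>
    show "canonical_oplax W T X V \<cdot> ar T (a \<otimes>\<^sub>a idn W V)
        = (a \<otimes>\<^sub>a idn W (ob T V)) \<cdot> canonical_oplax W T (ob T A, mu T A) V"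
      by (rule nat[OF FA X]) (use x in \<open>simp_all add: A_def a_def\<close>)
    show "canonical_oplax W T (ob T A, mu T A) V \<cdot> ar T (mu T A \<otimes>\<^sub>a idn W V)
        = (mu T A \<otimes>\<^sub>a idn W (ob T V)) \<cdot> canonical_oplax W T (ob T (ob T A), mu T (ob T A)) V"
      by (rule nat[OF FTA FA]) (use m mu_assoc[OF A] in simp_all)
    show "canonical_oplax W T (ob T A, mu T A) V \<cdot> ar T (ar T a \<otimes>\<^sub>a idn W V)
        = (ar T a \<otimes>\<^sub>a idn W (ob T V)) \<cdot> canonical_oplax W T (ob T (ob T A), mu T (ob T A)) V"
      by (rule nat[OF FTA FA]) (use Ta arrow_mu_natural[OF x(2)] in simp_all)
    show "ar T (a \<otimes>\<^sub>a idn W V) \<cdot> ar T (eta T A \<otimes>\<^sub>a idn W V) = idn W (ob T (A \<otimes>\<^sub>o V))"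
      using ar_whisker[OF e x(2)] x(4) C.tensa_idn[OF A V] ar_idn[OF C.tenso_Obj[OF A V]] by simp
    show "ar T (a \<otimes>\<^sub>a idn W V) \<cdot> ar T (mu T A \<otimes>\<^sub>a idn W V)
        = ar T (a \<otimes>\<^sub>a idn W V) \<cdot> ar T (ar T a \<otimes>\<^sub>a idn W V)"
      using ar_whisker[OF m x(2)] ar_whisker[OF Ta x(2)] x(3) by simp
    show "(a \<otimes>\<^sub>a idn W (ob T V)) \<cdot> (eta T A \<otimes>\<^sub>a idn W (ob T V)) = idn W (A \<otimes>\<^sub>o ob T V)"
      using fA[OF e x(2) TV] x(4) C.tensa_idn[OF A TV] by simp
    show "(mu T A \<otimes>\<^sub>a idn W (ob T V)) \<cdot> (eta T (ob T A) \<otimes>\<^sub>a idn W (ob T V))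
        = idn W (ob T A \<otimes>\<^sub>o ob T V)"
      using fA[OF e' m TV] mu_eta_left[OF A] C.tensa_idn[OF TA TV] by simp
    \<comment> \<open>This splitting identity is naturality of the unit at the arrow
      \<open>a\<close>, tensored with \<open>TV\<close>.\<close>
    show "(ar T a \<otimes>\<^sub>a idn W (ob T V)) \<cdot> (eta T (ob T A) \<otimes>\<^sub>a idn W (ob T V))
        = (eta T A \<otimes>\<^sub>a idn W (ob T V)) \<cdot> (a \<otimes>\<^sub>a idn W (ob T V))"
      using fA[OF e' Ta TV] fA[OF x(2) e TV] arrow_eta_natural[OF x(2)] by simp
  qed (intro arrow_ar whisker x(2) e e' m Ta V TV)+
qed

lemma right_fusion_invertible_iff:
  "right_fusion_invertible W T \<longleftrightarrow> canonical_oplax_invertible W T"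
proof
  assume "right_fusion_invertible W T"
  thus "canonical_oplax_invertible W T"
    by (simp add: canonical_oplax_invertible_def iso_canonical_oplax)
next
  assume inv: "canonical_oplax_invertible W T"
  show "right_fusion_invertible W T"
    unfolding right_fusion_invertible_def right_fusion_eq
  proof (intro ballI)
    fix A V assume "A \<in> Obj W" "V \<in> Obj W"
    thus "iso_arrow W (ob T (ob T A \<otimes>\<^sub>o V)) (ob T A \<otimes>\<^sub>o ob T V)
        (canonical_oplax W T (ob T A, mu T A) V)"
      using inv[unfolded canonical_oplax_invertible_def, rule_format, OF EM_free_Obj] by simp
  qed
qed

text \<open>The oplax module monad laws hold for every opmonoidal monad, so strength amounts to
  invertibility of the coherence morphisms.\<close>

lemma strong_module_monad_iff:
  "strong_module_monad k (EM W T) W (EM_action W) T (mu T) (eta T) (canonical_oplax W T)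
    \<longleftrightarrow> canonical_oplax_invertible W T"
  using canonical_oplax_module_monad
  by (auto simp: strong_module_monad_def strong_module_monad_axioms_def
      canonical_oplax_invertible_def)

end

theorem proposition9p15:
  fixes k :: "('k, 'r) ring_scheme"
    and W :: "('k, 'o, 'a, 'w) moncat_scheme"
    and T :: "('o, 'a, 't) opmonad_scheme"
  assumes "opmonoidal_monad k W T"
  shows "(right_fusion_invertible W T \<longleftrightarrow> canonical_oplax_invertible W T) \<and>
    (right_hopf_monad k W T \<longleftrightarrow>
      strong_module_monad k (EM W T) W (EM_action W) T (mu T) (eta T) (canonical_oplax W T))"
  using assms opmonoidal_monad.right_fusion_invertible_iff[OF assms]
    opmonoidal_monad.strong_module_monad_iff[OF assms]
  by (simp add: right_hopf_monad_def)

end
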